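(* Let $B=\{B_t,\ t\ge0\}$ be a centered Gaussian process with stationary increments, $B_0=0$, let $X_t=\theta t+B_t$, $\theta\in\mathbb{R}$, and fix $T>0$. Assume all finite-dimensional distributions of $\{B_t,\ t\in(0,T]\}$ are nonsingular, Assumption 1 holds (i.e. $\frac{\partial^2}{\partial s\,\partial t}\mathbb{E}[B_tB_s]=K(t-s)$ with $K$ even, $K\in L_1[-T,T]$), and Assumption 2 holds (there exists $h_T\in L_2[0,T]$ with $\Gamma_Th_T=\mathbf{1}$, where $\mathbf 1(t)=1$ on $[0,T]$). Let $P_\theta$ denote the distribution of $\{X_t,\ t\in[0,T]\}$ (so $P_0$ is the distribution of $B$ on $[0,T]$). Then $P_\theta$ is absolutely continuous with respect to $P_0$ with density $$L(\theta)=\frac{dP_\theta}{dP_0}=\exp\Big\{\theta\int_0^Th_T(s)\,dB_s-\frac{\theta^2}{2}\int_0^Th_T(s)\,ds\Big\},$$ i.e. $L(\theta)$ is a likelihood function for the continuous-time observation of $X$ on $[0,T]$ (in $L(\theta)$ the process $B$ denotes the coordinate process, which under $P_0$ is distributed as $B$).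
   Context: $\Gamma_T:L_2[0,T]\to L_2[0,T]$ is the operator $\Gamma_Tf(t)=\int_0^TK(t-s)f(s)\,ds$. The integral $\int_0^T f\,dB$ for $f\in L_2[0,T]$ is the mean-square limit of Riemann sums (it exists under Assumption 1). Equality $dP_\theta=L(\theta)\,dP_0$ is understood on the $\sigma$-algebra generated by the values of the process at finitely many time points of $[0,T]$. *)

theory Defs
  imports "HOL-Probability.Probability"
begin

definition centered_gaussian_rv :: "'a measure \<Rightarrow> ('a \<Rightarrow> real) \<Rightarrow> bool" where
  "centered_gaussian_rv M X \<longleftrightarrow> X \<in> borel_measurable M \<and>
     ((AE \<omega> in M. X \<omega> = 0) \<or> (\<exists>\<sigma>>0. distributed M lborel X (\<lambda>x. ennreal (normal_density 0 \<sigma> x))))"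

definition centered_gaussian_process :: "'a measure \<Rightarrow> (real \<Rightarrow> 'a \<Rightarrow> real) \<Rightarrow> bool" where
  "centered_gaussian_process M B \<longleftrightarrow>
     (\<forall>t\<ge>0. B t \<in> borel_measurable M) \<and>
     (\<forall>J c. finite J \<longrightarrow> J \<subseteq> {0..} \<longrightarrow>
        centered_gaussian_rv M (\<lambda>\<omega>. \<Sum>t\<in>J. c t * B t \<omega>))"

definition stationary_increments :: "'a measure \<Rightarrow> (real \<Rightarrow> 'a \<Rightarrow> real) \<Rightarrow> bool" where
  "stationary_increments M B \<longleftrightarrow>
     (\<forall>h\<ge>0. \<forall>J. finite J \<longrightarrow> J \<subseteq> {0..} \<longrightarrow>
        distr M (PiM J (\<lambda>_. borel)) (\<lambda>\<omega>. \<lambda>t\<in>J. B (t + h) \<omega> - B h \<omega>) =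
        distr M (PiM J (\<lambda>_. borel)) (\<lambda>\<omega>. \<lambda>t\<in>J. B t \<omega> - B 0 \<omega>))"

definition nonsingular_fdd :: "'a measure \<Rightarrow> (real \<Rightarrow> 'a \<Rightarrow> real) \<Rightarrow> real \<Rightarrow> bool" where
  "nonsingular_fdd M B T \<longleftrightarrow>
     (\<forall>J. finite J \<longrightarrow> J \<subseteq> {0<..T} \<longrightarrow>
       (\<forall>c. (\<forall>s\<in>J. (\<Sum>t\<in>J. (\<integral>\<omega>. B s \<omega> * B t \<omega> \<partial>M) * c t) = 0) \<longrightarrow> (\<forall>t\<in>J. c t = 0)))"

definition path_space :: "real \<Rightarrow> (real \<Rightarrow> real) measure" where
  "path_space T = PiM {0..T} (\<lambda>_. borel)"

definition law_X :: "'a measure \<Rightarrow> (real \<Rightarrow> 'a \<Rightarrow> real) \<Rightarrow> real \<Rightarrow> real \<Rightarrow> (real \<Rightarrow> real) measure" where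
  "law_X M B \<theta> T = distr M (path_space T) (\<lambda>\<omega>. \<lambda>t\<in>{0..T}. \<theta> * t + B t \<omega>)"

definition is_partition :: "real \<Rightarrow> nat \<Rightarrow> (nat \<Rightarrow> real) \<Rightarrow> bool" where
  "is_partition T n p \<longleftrightarrow> p 0 = 0 \<and> p n = T \<and> (\<forall>i<n. p i < p (Suc i))"

definition step_fun :: "nat \<Rightarrow> (nat \<Rightarrow> real) \<Rightarrow> (nat \<Rightarrow> real) \<Rightarrow> real \<Rightarrow> real" where
  "step_fun n p c s = (\<Sum>i<n. c i * indicator {p i<..p (Suc i)} s)"

definition step_int :: "(real \<Rightarrow> 'b \<Rightarrow> real) \<Rightarrow> nat \<Rightarrow> (nat \<Rightarrow> real) \<Rightarrow> (nat \<Rightarrow> real) \<Rightarrow> 'b \<Rightarrow> real" where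
  "step_int Y n p c x = (\<Sum>i<n. c i * (Y (p (Suc i)) x - Y (p i) x))"

definition ms_integral :: "'b measure \<Rightarrow> (real \<Rightarrow> 'b \<Rightarrow> real) \<Rightarrow> real \<Rightarrow> (real \<Rightarrow> real) \<Rightarrow> ('b \<Rightarrow> real) \<Rightarrow> bool" where
  "ms_integral M Y T f I \<longleftrightarrow> I \<in> borel_measurable M \<and>
     (\<forall>n p c. (\<forall>k. is_partition T (n k) (p k)) \<and>
        ((\<lambda>k. \<integral>\<^sup>+ s\<in>{0..T}. ennreal ((step_fun (n k) (p k) (c k) s - f s)\<^sup>2) \<partial>lborel) \<longlonglongrightarrow> 0)
      \<longrightarrow> ((\<lambda>k. \<integral>\<^sup>+ x. ennreal ((step_int Y (n k) (p k) (c k) x - I x)\<^sup>2) \<partial>M) \<longlonglongrightarrow> 0))"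

end

theory Submission
  imports Defs
begin

text \<open>
  Under Assumption 1 the covariance of two integrals of step functions \<open>f\<close> and \<open>g\<close> against \<open>B\<close> is
  \<open>\<integral>\<integral> f(u) g(v) K(u - v)\<close>, a form bounded on \<open>L\<^sub>2\<close> by the \<open>L\<^sub>1\<close> norm of \<open>K\<close>. Hence the integral extends to
  \<open>L\<^sub>2\<close>, and \<open>I = \<integral> h dB\<close> is jointly Gaussian with the process; the integral equation for \<open>h\<close> says that the
  covariance of \<open>I\<close> and \<open>B\<^sub>t\<close> is \<open>t\<close> and that the variance of \<open>I\<close> is \<open>\<integral> h\<close>. Weighting a Gaussian law by
  \<open>exp(\<theta> I - \<theta>\<^sup>2 Var(I) / 2)\<close> shifts each coordinate by \<open>\<theta>\<close> times its covariance with \<open>I\<close>, that is, \<open>B\<^sub>t\<close> by \<open>\<theta> t\<close>.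
  This is checked on characteristic functions, which determine the finite-dimensional laws, and these
  determine the measure on path space.
\<close>

subsection \<open>Uniqueness for weighted characteristic functions\<close>

text \<open>The obstacle is that the Gaussian laws are known through characteristic functions, that
  is, at imaginary exponents, while the weight \<open>exp (\<theta> * I x)\<close> is unbounded and
  moves the exponent off the imaginary axis. Neither analytic continuation nor a joint density is
  used. One tool serves twice: one-dimensional Levy uniqueness under nonnegative integrable weights.
  It yields the joint law of finitely many coordinates, and it evaluates a complex exponential of
  \<open>I\<close> by comparison with a scaled standard normal variable. For the latter, a
  combination \<open>Z\<close> of process values is split as \<open>V + a * I\<close> with
  \<open>a\<close> the covariance of \<open>Z\<close> and \<open>I\<close> divided by the variance
  of \<open>I\<close>, so that the complex exponent affects a single real variable. The division
  requires a positive variance; this is forced by the covariance \<open>T > 0\<close> of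
  \<open>I\<close> with the value of the process at \<open>T\<close>. Errors are measured by squared
  norms, with the inequality of Young in place of Cauchy-Schwarz; hence the free parameters
  \<epsilon> and the factors 2. The integral is built on path space under the law of
  \<open>B\<close>, because a density must be a function of the path.\<close>

lemma weighted_char_determines_integral:
  fixes X1 :: "'a \<Rightarrow> real" and X2 :: "'b \<Rightarrow> real" and w1 :: "'a \<Rightarrow> real" and w2 :: "'b \<Rightarrow> real"
    and g :: "real \<Rightarrow> 'c::{banach, second_countable_topology}"
  assumes [measurable]: "X1 \<in> borel_measurable M1" "X2 \<in> borel_measurable M2"
    and w1: "integrable M1 w1" "\<And>x. 0 \<le> w1 x" and w2: "integrable M2 w2" "\<And>x. 0 \<le> w2 x"
    and eq: "\<And>s. (CLINT x|M1. w1 x *\<^sub>R iexp (s * X1 x)) = (CLINT x|M2. w2 x *\<^sub>R iexp (s * X2 x))"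
    and [measurable]: "g \<in> borel_measurable borel"
  shows "(\<integral>x. w1 x *\<^sub>R g (X1 x) \<partial>M1) = (\<integral>x. w2 x *\<^sub>R g (X2 x) \<partial>M2)"
    and "integrable M1 (\<lambda>x. w1 x *\<^sub>R g (X1 x)) \<longleftrightarrow> integrable M2 (\<lambda>x. w2 x *\<^sub>R g (X2 x))"
proof -
  have [measurable]: "w1 \<in> borel_measurable M1" "w2 \<in> borel_measurable M2"
    using w1 w2 by auto
  define m where "m = (\<integral>x. w1 x \<partial>M1)"
  have "complex_of_real m = complex_of_real (\<integral>x. w2 x \<partial>M2)"
    using eq[of 0] by (simp add: m_def scaleR_conv_of_real)
  then have m2: "m = (\<integral>x. w2 x \<partial>M2)" by simp
  have "m \<ge> 0" using w1 by (simp add: m_def)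
  have "(\<integral>x. w1 x *\<^sub>R g (X1 x) \<partial>M1) = (\<integral>x. w2 x *\<^sub>R g (X2 x) \<partial>M2) \<and>
    (integrable M1 (\<lambda>x. w1 x *\<^sub>R g (X1 x)) \<longleftrightarrow> integrable M2 (\<lambda>x. w2 x *\<^sub>R g (X2 x)))"
  proof (cases "m = 0")
    \<comment> \<open>Weights of total mass zero cannot be normalised, but they vanish almost
      everywhere, so both sides are trivial.\<close>
    case True
    have "AE x in M1. w1 x = 0" "AE x in M2. w2 x = 0"
      using True m_def m2 w1 w2 integral_nonneg_eq_0_iff_AE[of M1 w1] integral_nonneg_eq_0_iff_AE[of M2 w2]
      by auto
    then have a: "AE x in M1. w1 x *\<^sub>R g (X1 x) = 0" "AE x in M2. w2 x *\<^sub>R g (X2 x) = 0"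
      by (auto elim: eventually_mono)
    show ?thesis
      using integral_cong_AE[OF _ _ a(1)] integral_cong_AE[OF _ _ a(2)]
        integrable_cong_AE[OF _ _ a(1)] integrable_cong_AE[OF _ _ a(2)] by simp
  next
    case False
    with \<open>m \<ge> 0\<close> have m: "m > 0" by simp
    \<comment> \<open>The hypothesis at \<open>s = 0\<close> gives both weights the same mass
      \<open>m\<close>. Dividing by it produces probability measures, and the hypothesis says that
      the images under \<open>X1\<close> and \<open>X2\<close> have equal characteristic functions.
      Equality of these images covers every Borel \<open>g\<close>, bounded or not, together with
      its integrability.\<close>
    define N1 where "N1 = density M1 (\<lambda>x. ennreal (w1 x / m))"
    define N2 where "N2 = density M2 (\<lambda>x. ennreal (w2 x / m))"
    have i2: "(\<integral>x. f x \<partial>N2) = (\<integral>x. (w2 x / m) *\<^sub>R f x \<partial>M2)"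
      if [measurable]: "f \<in> borel_measurable M2" 
      for f :: "'b \<Rightarrow> 'd::{banach, second_countable_topology}"
      using m w2 unfolding N2_def by (auto intro!: integral_density)
    have i1: "(\<integral>x. f x \<partial>N1) = (\<integral>x. (w1 x / m) *\<^sub>R f x \<partial>M1)"
      if [measurable]: "f \<in> borel_measurable M1" 
      for f :: "'a \<Rightarrow> 'd::{banach, second_countable_topology}"
      using m w1 unfolding N1_def by (auto intro!: integral_density)
    have "prob_space N1" "prob_space N2"
    proof -
      have "(\<integral>\<^sup>+x. ennreal (w1 x / m) \<partial>M1) = ennreal (\<integral>x. w1 x / m \<partial>M1)"
        using w1 m by (intro nn_integral_eq_integral) auto
      also have "\<dots> = 1" using m by (simp add: m_def[symmetric])
      finally show "prob_space N1"
        unfolding N1_def by (intro prob_spaceI) (simp add: emeasure_density cong: nn_integral_cong_simp)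
      have "(\<integral>\<^sup>+x. ennreal (w2 x / m) \<partial>M2) = ennreal (\<integral>x. w2 x / m \<partial>M2)"
        using w2 m by (intro nn_integral_eq_integral) auto
      also have "\<dots> = 1" using m by (simp add: m2[symmetric])
      finally show "prob_space N2"
        unfolding N2_def by (intro prob_spaceI) (simp add: emeasure_density cong: nn_integral_cong_simp)
    qed
    then interpret N1: prob_space N1 + N2: prob_space N2 .
    have [measurable]: "X1 \<in> borel_measurable N1" "X2 \<in> borel_measurable N2"
      by (auto simp: N1_def N2_def)
    have sc: "(\<integral>x. (w x / m) *\<^sub>R f x \<partial>M) = (1 / m) *\<^sub>R (\<integral>x. w x *\<^sub>R f x \<partial>M)"
      for w and M :: "'e measure" and f :: "'e \<Rightarrow> 'd::{banach, second_countable_topology}"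
      by (subst integral_scaleR_right[symmetric]) (simp add: field_simps)
    have "distr N1 borel X1 = distr N2 borel X2"
    proof (rule Levy_uniqueness)
      show "real_distribution (distr N1 borel X1)" "real_distribution (distr N2 borel X2)"
        by (auto intro!: N1.real_distribution_distr N2.real_distribution_distr)
      show "char (distr N1 borel X1) = char (distr N2 borel X2)"
        by (rule ext) (simp add: char_def integral_distr i1 i2 sc eq[unfolded of_real_mult])
    qed
    note D = this
    have int_sc: "integrable M (\<lambda>x. (1 / m) *\<^sub>R f x) \<longleftrightarrow> integrable M f"
      for M :: "'e measure" and f :: "'e \<Rightarrow> 'c"
      using integrable_scaleR_right[of "1 / m" M f]
        integrable_scaleR_right[of m M "\<lambda>x. (1 / m) *\<^sub>R f x"] m by auto
    have "(\<integral>x. g (X1 x) \<partial>N1) = (\<integral>x. g (X2 x) \<partial>N2)"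
      using arg_cong[OF D, of "\<lambda>M. \<integral>x. g x \<partial>M"] by (simp add: integral_distr)
    moreover have "integrable N1 (\<lambda>x. g (X1 x)) \<longleftrightarrow> integrable N2 (\<lambda>x. g (X2 x))"
      using arg_cong[OF D, of "\<lambda>M. integrable M g"] by (simp add: integrable_distr_eq)
    moreover have "integrable N1 (\<lambda>x. g (X1 x)) \<longleftrightarrow> integrable M1 (\<lambda>x. (1 / m) *\<^sub>R (w1 x *\<^sub>R g (X1 x)))"
      unfolding N1_def using w1 m by (subst integrable_density) auto
    moreover have "integrable N2 (\<lambda>x. g (X2 x)) \<longleftrightarrow> integrable M2 (\<lambda>x. (1 / m) *\<^sub>R (w2 x *\<^sub>R g (X2 x)))"
      unfolding N2_def using w2 m by (subst integrable_density) auto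
    ultimately show ?thesis
      using m by (simp add: i1 i2 sc int_sc del: scaleR_scaleR)
  qed
  then show "(\<integral>x. w1 x *\<^sub>R g (X1 x) \<partial>M1) = (\<integral>x. w2 x *\<^sub>R g (X2 x) \<partial>M2)"
    and "integrable M1 (\<lambda>x. w1 x *\<^sub>R g (X1 x)) \<longleftrightarrow> integrable M2 (\<lambda>x. w2 x *\<^sub>R g (X2 x))" by auto
qed

text \<open>This is the inductive step towards joint laws: \<open>g1\<close> and \<open>g2\<close>
  stand for factors coming from the other coordinates, and the exponential of one coordinate is
  exchanged for an indicator.\<close>

lemma char_determines_integral_indicator:
  fixes X1 :: "'a \<Rightarrow> real" and X2 :: "'b \<Rightarrow> real" and g1 :: "'a \<Rightarrow> complex" and g2 :: "'b \<Rightarrow> complex"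
  assumes fin: "finite_measure M1" "finite_measure M2"
    and m [measurable]: "X1 \<in> borel_measurable M1" "X2 \<in> borel_measurable M2"
      "g1 \<in> borel_measurable M1" "g2 \<in> borel_measurable M2"
    and bnd: "\<And>x. norm (g1 x) \<le> 1" "\<And>x. norm (g2 x) \<le> 1"
    and eq1: "\<And>s. (CLINT x|M1. iexp (s * X1 x)) = (CLINT x|M2. iexp (s * X2 x))"
    and eqg: "\<And>s. (CLINT x|M1. g1 x * iexp (s * X1 x)) = (CLINT x|M2. g2 x * iexp (s * X2 x))"
    and [measurable]: "A \<in> sets borel"
  shows "(CLINT x|M1. g1 x * indicator A (X1 x)) = (CLINT x|M2. g2 x * indicator A (X2 x))"
proof -
  have integ: "integrable M f" if "finite_measure M" "f \<in> borel_measurable M" "\<And>x. norm (f x) \<le> 1"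
    for M :: "'c measure" and f :: "'c \<Rightarrow> 'd::{banach, second_countable_topology}"
    using that by (auto intro!: finite_measure.integrable_const_bound[where B = 1])
  have bnd': "norm (a * iexp t) \<le> 1" "norm (cnj a * iexp t) \<le> 1" "norm (iexp t) \<le> 1"
    "norm (a * indicator A t) \<le> 1" "norm (indicator A t :: complex) \<le> 1"
    "norm (Re a *\<^sub>R (indicator A t :: complex)) \<le> 1" "norm (Im a *\<^sub>R (indicator A t :: complex)) \<le> 1"
    if "norm a \<le> 1" for a t
    using that abs_Re_le_cmod[of a] abs_Im_le_cmod[of a] by (auto simp: norm_mult indicator_def)
  \<comment> \<open>Real and imaginary parts of \<open>g\<close> are combinations of
    \<open>g\<close> and its conjugate. Conjugating an integral flips the sign of \<open>s\<close>,
    so the hypothesis at \<open>- s\<close> supplies the conjugate term. The third identity recovers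
    \<open>g\<close> from the two shifted weights.\<close>
  have W: "(CLINT x|M. (1 + Re (g x)) *\<^sub>R iexp (s * X x)) =
        (CLINT x|M. iexp (s * X x)) +
        ((CLINT x|M. g x * iexp (s * X x)) + cnj (CLINT x|M. g x * iexp ((- s) * X x))) / 2"
      "(CLINT x|M. (1 + Im (g x)) *\<^sub>R iexp (s * X x)) =
        (CLINT x|M. iexp (s * X x)) +
        ((CLINT x|M. g x * iexp (s * X x)) - cnj (CLINT x|M. g x * iexp ((- s) * X x))) / (2 * \<i>)"
      "(CLINT x|M. g x * indicator A (X x)) =
         ((CLINT x|M. (1 + Re (g x)) *\<^sub>R indicator A (X x)) - (CLINT x|M. indicator A (X x)))
         + \<i> * ((CLINT x|M. (1 + Im (g x)) *\<^sub>R indicator A (X x)) - (CLINT x|M. indicator A (X x)))"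
      "integrable M (\<lambda>x. 1 + Re (g x))" "integrable M (\<lambda>x. 1 + Im (g x))" "integrable M (\<lambda>x. 1::real)"
    if fM: "finite_measure M" and [measurable]: "X \<in> borel_measurable M" "g \<in> borel_measurable M"
      and b: "\<And>x. norm (g x) \<le> 1"
    for M :: "'c measure" and X g s
  proof -
    have [measurable]: "(\<lambda>x. cnj (g x)) \<in> borel_measurable M"
      by (intro measurable_compose[OF _ borel_measurable_continuous_onI[of cnj]] continuous_intros) simp
    have c: "cnj (CLINT x|M. g x * iexp ((- s) * X x)) = (CLINT x|M. cnj (g x) * iexp (s * X x))"
      by (subst Bochner_Integration.integral_cnj[symmetric]) (simp add: exp_cnj)
    have i: "integrable M (\<lambda>x. g x * iexp (s * X x))" "integrable M (\<lambda>x. cnj (g x) * iexp (s * X x))"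
      "integrable M (\<lambda>x. iexp (s * X x))" "integrable M (\<lambda>x. indicator A (X x) :: complex)"
      "integrable M (\<lambda>x. Re (g x) *\<^sub>R (indicator A (X x) :: complex))"
      "integrable M (\<lambda>x. Im (g x) *\<^sub>R (indicator A (X x) :: complex))"
      using bnd'[OF b] by (auto intro!: integ[OF fM] simp del: of_real_mult)
    have "(CLINT x|M. (1 + Re (g x)) *\<^sub>R iexp (s * X x)) =
      (CLINT x|M. iexp (s * X x) + (g x * iexp (s * X x) + cnj (g x) * iexp (s * X x)) / 2)"
    proof (intro Bochner_Integration.integral_cong refl)
      fix x
      have "g x * iexp (s * X x) + cnj (g x) * iexp (s * X x) = 2 * (Re (g x) * iexp (s * X x))"
        by (simp add: complex_add_cnj flip: distrib_right)
      then show "(1 + Re (g x)) *\<^sub>R iexp (s * X x) = iexp (s * X x) + (g x * iexp (s * X x) + cnj (g x) * iexp (s * X x)) / 2"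
        by (simp add: scaleR_conv_of_real distrib_right)
    qed
    then show "(CLINT x|M. (1 + Re (g x)) *\<^sub>R iexp (s * X x)) =
        (CLINT x|M. iexp (s * X x)) +
        ((CLINT x|M. g x * iexp (s * X x)) + cnj (CLINT x|M. g x * iexp ((- s) * X x))) / 2"
      unfolding c using i by (simp del: of_real_mult)
    have "(CLINT x|M. (1 + Im (g x)) *\<^sub>R iexp (s * X x)) =
      (CLINT x|M. iexp (s * X x) + (g x * iexp (s * X x) - cnj (g x) * iexp (s * X x)) / (2 * \<i>))"
    proof (intro Bochner_Integration.integral_cong refl)
      fix x
      have "g x * iexp (s * X x) - cnj (g x) * iexp (s * X x) = (2 * \<i>) * (Im (g x) * iexp (s * X x))"
        by (simp add: complex_diff_cnj flip: left_diff_distrib)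
      then show "(1 + Im (g x)) *\<^sub>R iexp (s * X x) = iexp (s * X x) + (g x * iexp (s * X x) - cnj (g x) * iexp (s * X x)) / (2 * \<i>)"
        by (simp add: scaleR_conv_of_real distrib_right)
    qed
    then show "(CLINT x|M. (1 + Im (g x)) *\<^sub>R iexp (s * X x)) =
        (CLINT x|M. iexp (s * X x)) +
        ((CLINT x|M. g x * iexp (s * X x)) - cnj (CLINT x|M. g x * iexp ((- s) * X x))) / (2 * \<i>)"
      unfolding c using i by (simp del: of_real_mult)
    have "(CLINT x|M. g x * indicator A (X x)) =
      (CLINT x|M. Re (g x) *\<^sub>R indicator A (X x) + \<i> * (Im (g x) *\<^sub>R indicator A (X x)))"
      by (intro Bochner_Integration.integral_cong refl)
         (auto simp: scaleR_conv_of_real indicator_def complex_eq)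
    then show "(CLINT x|M. g x * indicator A (X x)) =
         ((CLINT x|M. (1 + Re (g x)) *\<^sub>R indicator A (X x)) - (CLINT x|M. indicator A (X x)))
         + \<i> * ((CLINT x|M. (1 + Im (g x)) *\<^sub>R indicator A (X x)) - (CLINT x|M. indicator A (X x)))"
      using i by (simp only: scaleR_left_distrib scaleR_one Bochner_Integration.integral_add
          Bochner_Integration.integrable_add integral_mult_right_zero integrable_mult_right add_diff_cancel_left')
    have ig: "integrable M g" using b by (intro integ[OF fM]) auto
    show i1: "integrable M (\<lambda>x. 1::real)" by (rule finite_measure.integrable_const[OF fM])
    show "integrable M (\<lambda>x. 1 + Re (g x))"
      by (rule Bochner_Integration.integrable_add[OF i1 integrable_Re[OF ig]])
    show "integrable M (\<lambda>x. 1 + Im (g x))"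
      by (rule Bochner_Integration.integrable_add[OF i1 integrable_Im[OF ig]])
  qed
  \<comment> \<open>As \<open>g\<close> is bounded by 1, the weights \<open>1 + Re g\<close> and \<open>1 + Im g\<close> are nonnegative, so that Levy's
    uniqueness theorem for probability measures applies to a complex factor.\<close>
  have pos: "0 \<le> 1 + Re (g1 x)" "0 \<le> 1 + Im (g1 x)" "0 \<le> 1 + Re (g2 y)" "0 \<le> 1 + Im (g2 y)" for x y
    using bnd(1)[of x] bnd(2)[of y] abs_Re_le_cmod[of "g1 x"] abs_Im_le_cmod[of "g1 x"]
      abs_Re_le_cmod[of "g2 y"] abs_Im_le_cmod[of "g2 y"] by (auto simp: abs_le_iff)
  note W1 = W[OF fin(1) m(1) m(3) bnd(1)] and W2 = W[OF fin(2) m(2) m(4) bnd(2)]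
  have "(CLINT x|M1. (1 + Re (g1 x)) *\<^sub>R indicator A (X1 x)) = (CLINT x|M2. (1 + Re (g2 x)) *\<^sub>R indicator A (X2 x))"
    by (rule weighted_char_determines_integral(1)[OF m(1) m(2) W1(4) pos(1) W2(4) pos(3)])
       (unfold W1(1) W2(1) eq1 eqg, simp_all)
  moreover have "(CLINT x|M1. (1 + Im (g1 x)) *\<^sub>R indicator A (X1 x)) = (CLINT x|M2. (1 + Im (g2 x)) *\<^sub>R indicator A (X2 x))"
    by (rule weighted_char_determines_integral(1)[OF m(1) m(2) W1(5) pos(2) W2(5) pos(4)])
       (unfold W1(2) W2(2) eq1 eqg, simp_all)
  moreover have "(CLINT x|M1. 1 *\<^sub>R indicator A (X1 x)) = (CLINT x|M2. 1 *\<^sub>R indicator A (X2 x))"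
    by (rule weighted_char_determines_integral(1)[OF m(1) m(2) W1(6) zero_le_one W2(6) zero_le_one])
       (unfold scaleR_one eq1, simp_all)
  ultimately show ?thesis
    unfolding W1(3) W2(3) scaleR_one by simp
qed

text \<open>Multivariate uniqueness is derived from the one-dimensional theorem. Finite measures are
  allowed because one side will be a measure given by a density whose total mass is not known in
  advance; equality of masses is the case \<open>c = 0\<close>.\<close>

lemma char_determines_joint_law:
  fixes X1 :: "'i \<Rightarrow> 'a \<Rightarrow> real" and X2 :: "'i \<Rightarrow> 'b \<Rightarrow> real"
  assumes fin: "finite_measure M1" "finite_measure M2" and J: "finite J"
    and X1: "\<And>j. j \<in> J \<Longrightarrow> X1 j \<in> borel_measurable M1"
    and X2: "\<And>j. j \<in> J \<Longrightarrow> X2 j \<in> borel_measurable M2"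
    and A: "\<And>j. j \<in> J \<Longrightarrow> A j \<in> sets borel"
    and eq: "\<And>c. (CLINT x|M1. iexp (\<Sum>j\<in>J. c j * X1 j x)) = (CLINT x|M2. iexp (\<Sum>j\<in>J. c j * X2 j x))"
  shows "measure M1 {x \<in> space M1. \<forall>j\<in>J. X1 j x \<in> A j} = measure M2 {x \<in> space M2. \<forall>j\<in>J. X2 j x \<in> A j}"
proof -
  have eqk: "(CLINT x|M1. iexp (s * X1 k x)) = (CLINT x|M2. iexp (s * X2 k x))" if "k \<in> J" for s k
  proof -
    have *: "(\<Sum>j\<in>J. (if j = k then s else 0) * Y j) = s * Y k" for Y :: "'i \<Rightarrow> real"
      using that J by (simp add: if_distrib[of "\<lambda>x. x * _"] sum.delta cong: if_cong)
    show ?thesis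
      using eq[of "\<lambda>j. if j = k then s else 0"] unfolding * .
  qed
  \<comment> \<open>The exponential factors are replaced by indicators one coordinate at a time.\<close>
  have "S \<subseteq> J \<longrightarrow> (\<forall>c. (CLINT x|M1. (\<Prod>j\<in>S. indicator (A j) (X1 j x)) * iexp (\<Sum>j\<in>J-S. c j * X1 j x))
       = (CLINT x|M2. (\<Prod>j\<in>S. indicator (A j) (X2 j x)) * iexp (\<Sum>j\<in>J-S. c j * X2 j x)))"
    if "finite S" for S
    using that
  proof (induction S)
    case empty
    then show ?case using eq by simp
  next
    case (insert k S)
    show ?case
    proof (intro impI allI)
      fix c assume kS: "insert k S \<subseteq> J"
      then have k: "k \<in> J" "k \<notin> S" and S: "S \<subseteq> J" using insert by auto
      have [measurable]: "X1 j \<in> borel_measurable M1" "X2 j \<in> borel_measurable M2" "A j \<in> sets borel"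
        if "j \<in> S" for j
        using X1 X2 A S that by auto
      have [measurable]: "X1 j \<in> borel_measurable M1" "X2 j \<in> borel_measurable M2"
        if "j \<in> J - insert k S" for j
        using X1 X2 that by auto
      have [measurable]: "X1 k \<in> borel_measurable M1" "X2 k \<in> borel_measurable M2" "A k \<in> sets borel"
        using X1 X2 A k by auto
      define G where "G y = (\<Prod>j\<in>S. indicator (A j) (y j)) * iexp (\<Sum>j\<in>J-insert k S. c j * y j)"
        for y
      have G: "norm (G y) \<le> 1" for y
      proof -
        have "norm (\<Prod>j\<in>S. indicator (A j) (y j) :: complex) \<le> (\<Prod>j\<in>S. 1)"
          unfolding prod_norm[symmetric] by (intro prod_mono) (auto simp: indicator_def)
        then show ?thesis unfolding G_def norm_mult by (simp del: of_real_sum)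
      qed
      have "(\<Sum>j\<in>J-S. (c(k:=s)) j * y j) = (\<Sum>j\<in>J-insert k S. c j * y j) + s * y k"
        for y s
      proof -
        have eqJ: "J - S = insert k (J - insert k S)" using k by auto
        have "(\<Sum>j\<in>J-S. (c(k:=s)) j * y j) = (\<Sum>j\<in>insert k (J-insert k S). (c(k:=s)) j * y j)"
          by (rule sum.cong[OF eqJ refl])
        also have "\<dots> = s * y k + (\<Sum>j\<in>J-insert k S. (c(k:=s)) j * y j)"
          using J by (subst sum.insert) auto
        also have "(\<Sum>j\<in>J-insert k S. (c(k:=s)) j * y j) = (\<Sum>j\<in>J-insert k S. c j * y j)"
          by (intro sum.cong) auto
        finally show ?thesis by simp
      qed
      then have split: "(\<Prod>j\<in>S. indicator (A j) (y j)) * iexp (\<Sum>j\<in>J-S. (c(k:=s)) j * y j) = G y * iexp (s * y k)"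
        for y s
        by (simp add: G_def exp_add[symmetric] distrib_left mult.assoc del: of_real_sum)
      have prodG: "(\<Prod>j\<in>insert k S. indicator (A j) (y j)) * iexp (\<Sum>j\<in>J-insert k S. c j * y j) = G y * indicator (A k) (y k)"
        for y
        using insert by (simp add: G_def)
      have "(CLINT x|M1. G (\<lambda>j. X1 j x) * iexp (s * X1 k x)) = (CLINT x|M2. G (\<lambda>j. X2 j x) * iexp (s * X2 k x))" for s
        using insert.IH[rule_format, OF S, of "c(k:=s)"] unfolding split .
      moreover have "(\<lambda>x. G (\<lambda>j. X1 j x)) \<in> borel_measurable M1" "(\<lambda>x. G (\<lambda>j. X2 j x)) \<in> borel_measurable M2"
        unfolding G_def by (auto intro!: borel_measurable_times borel_measurable_prod simp del: of_real_sum)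
      ultimately show "(CLINT x|M1. (\<Prod>j\<in>insert k S. indicator (A j) (X1 j x)) * iexp (\<Sum>j\<in>J-insert k S. c j * X1 j x))
       = (CLINT x|M2. (\<Prod>j\<in>insert k S. indicator (A j) (X2 j x)) * iexp (\<Sum>j\<in>J-insert k S. c j * X2 j x))"
        unfolding prodG using G eqk[OF k(1)] fin
        by (intro char_determines_integral_indicator) auto
    qed
  qed
  from this[OF J] have *: "(CLINT x|M1. (\<Prod>j\<in>J. indicator (A j) (X1 j x))) = (CLINT x|M2. (\<Prod>j\<in>J. indicator (A j) (X2 j x)))"
    by simp
  have **: "(CLINT x|M. (\<Prod>j\<in>J. indicator (A j) (Y j x))) = complex_of_real (measure M {x \<in> space M. \<forall>j\<in>J. Y j x \<in> A j})"
    if "finite_measure M" and Y: "\<And>j. j \<in> J \<Longrightarrow> Y j \<in> borel_measurable M" for M :: "'c measure" and Y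
  proof -
    interpret finite_measure M by fact
    have [measurable]: "{x \<in> space M. \<forall>j\<in>J. Y j x \<in> A j} \<in> sets M"
      using J by (intro sets.sets_Collect_finite_All)
        (auto intro!: measurable_sets_Collect[OF Y] A)
    have "(CLINT x|M. (\<Prod>j\<in>J. indicator (A j) (Y j x))) = (CLINT x|M. indicator {x \<in> space M. \<forall>j\<in>J. Y j x \<in> A j} x)"
      using J by (intro Bochner_Integration.integral_cong refl) (auto simp: indicator_def prod_zero_iff intro!: prod.neutral)
    also have "\<dots> = (CLINT x|M. complex_of_real (indicator {x \<in> space M. \<forall>j\<in>J. Y j x \<in> A j} x))"
      by (intro Bochner_Integration.integral_cong refl) (auto simp: indicator_def)
    also have "\<dots> = complex_of_real (measure M {x \<in> space M. \<forall>j\<in>J. Y j x \<in> A j})"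
      by (subst integral_complex_of_real) (simp add: Int_absorb2)
    finally show ?thesis .
  qed
  show ?thesis
    using * **[OF fin(1) X1] **[OF fin(2) X2] by simp
qed

section \<open>Gaussian expectations with a complex exponent\<close>

lemma std_normal_exp:
  fixes b t :: real
  shows "integrable std_normal_distribution (\<lambda>x. exp ((complex_of_real b + \<i> * t) * complex_of_real x))" (is ?I)
    and "(CLINT x|std_normal_distribution. exp ((complex_of_real b + \<i> * t) * complex_of_real x))
      = exp ((complex_of_real b + \<i> * t)\<^sup>2 / 2)" (is ?E)
proof -
  let ?f = "\<lambda>x. (exp (b\<^sup>2 / 2) * std_normal_density (x - b)) *\<^sub>R iexp (t * x)"
  \<comment> \<open>Completing the square turns the real part \<open>b\<close> of the exponent into
    a translation of the density by \<open>b\<close>. What is left is an ordinary characteristic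
    function at \<open>t\<close>.\<close>
  have "std_normal_density x * exp (b * x) = exp (b\<^sup>2 / 2) * std_normal_density (x - b)" for x
    by (simp add: normal_density_def exp_add[symmetric] power2_eq_square field_simps)
  note dens = this
  have eq: "std_normal_density x *\<^sub>R exp ((complex_of_real b + \<i> * t) * complex_of_real x) = ?f x" for x
  proof -
    have "exp ((complex_of_real b + \<i> * t) * complex_of_real x) = complex_of_real (exp (b * x)) * iexp (t * x)"
      by (simp add: exp_of_real[symmetric] exp_add[symmetric] distrib_right mult.assoc del: exp_of_real)
    then show ?thesis
      using arg_cong[OF dens[of x], of complex_of_real]
      by (simp add: scaleR_conv_of_real mult.assoc[symmetric])
  qed
  \<comment> \<open>The argument is written \<open>b + 1 * y\<close> to match the affine change of
    variables for \<open>lborel\<close>.\<close>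
  have shift: "?f (b + 1 * y) = (exp (b\<^sup>2 / 2) * iexp (t * b)) * (std_normal_density y *\<^sub>R iexp (t * y))" for y
    by (simp add: scaleR_conv_of_real exp_add[symmetric] distrib_left)
  have int0: "integrable lborel (\<lambda>y. std_normal_density y *\<^sub>R iexp (t * y))"
  proof -
    have "integrable std_normal_distribution (\<lambda>x. iexp (t * x))"
      using real_distribution.axioms(1)[OF real_dist_normal_dist]
      by (intro prob_space.integrable_iexp) auto
    then show ?thesis
      by (subst (asm) integrable_density) auto
  qed
  have "integrable lborel (\<lambda>y. ?f (b + 1 * y))"
    unfolding shift using int0 by (intro integrable_mult_right) auto
  then have "integrable lborel ?f"
    by (subst (asm) lborel_integrable_real_affine_iff) auto
  then show ?I
    by (subst integrable_density) (auto simp: eq)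
  have "(CLINT x|std_normal_distribution. exp ((complex_of_real b + \<i> * t) * complex_of_real x)) = (CLINT x|lborel. ?f x)"
    by (subst integral_density) (auto simp: eq)
  also have "\<dots> = (CLINT y|lborel. ?f (b + 1 * y))"
    by (subst lborel_integral_real_affine[of 1 _ b]) auto
  also have "\<dots> = (exp (b\<^sup>2 / 2) * iexp (t * b)) * (CLINT y|lborel. std_normal_density y *\<^sub>R iexp (t * y))"
    unfolding shift using int0 by (intro Bochner_Integration.integral_mult_right) auto
  also have "(CLINT y|lborel. std_normal_density y *\<^sub>R iexp (t * y)) = char std_normal_distribution t"
    unfolding char_def by (subst integral_density) auto
  also have "\<dots> = exp (- (t\<^sup>2) / 2)"
    by (simp add: char_std_normal_distribution)
  also have "(exp (b\<^sup>2 / 2) * iexp (t * b)) * exp (- (t\<^sup>2) / 2) = exp ((complex_of_real b + \<i> * t)\<^sup>2 / 2)"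
    by (simp add: exp_of_real[symmetric] exp_add[symmetric] power2_sum power_mult_distrib add_divide_distrib diff_divide_distrib,
        simp add: algebra_simps)
  finally show ?E .
qed

text \<open>By hypothesis \<open>V\<close> behaves as if independent of \<open>I\<close>, but only for exponents \<open>i s\<close>; the uniqueness
  theorem with the weights \<open>1 + cos V\<close> and \<open>1 + sin V\<close> carries this over to the complex exponent \<open>\<theta> + i a\<close>.\<close>

lemma gaussian_exp_weighted:
  fixes V I :: "'a \<Rightarrow> real" and c \<sigma> a \<theta> :: real
  assumes "prob_space P" and V[measurable]: "V \<in> borel_measurable P" and I[measurable]: "I \<in> borel_measurable P"
    and c: "0 \<le> c"
    and eI: "\<And>s. (CLINT x|P. iexp (s * I x)) = exp (- (s * \<sigma>)\<^sup>2 / 2)"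
    and eV: "\<And>s. (CLINT x|P. iexp (V x + s * I x)) = c * exp (- (s * \<sigma>)\<^sup>2 / 2)"
  shows "integrable P (\<lambda>x. exp (\<theta> * I x))"
    and "(CLINT x|P. iexp (V x + a * I x) * exp (\<theta> * I x)) = c * exp ((complex_of_real \<theta> + \<i> * a)\<^sup>2 * \<sigma>\<^sup>2 / 2)"
proof -
  interpret prob_space P by fact
  have int: "integrable P f" if "f \<in> borel_measurable P" "\<And>x. norm (f x) \<le> 2"
    for f :: "'a \<Rightarrow> 'd::{banach, second_countable_topology}"
    using that by (auto intro!: integrable_const_bound[where B = 2])
  have eV': "(CLINT x|P. iexp (- V x + s * I x)) = c * exp (- (s * \<sigma>)\<^sup>2 / 2)" for s
  proof -
    have "(CLINT x|P. iexp (- V x + s * I x)) = (CLINT x|P. cnj (iexp (V x + (- s) * I x)))"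
      by (intro Bochner_Integration.integral_cong refl) (simp add: exp_cnj algebra_simps)
    also have "\<dots> = cnj (CLINT x|P. iexp (V x + (- s) * I x))"
      by (rule Bochner_Integration.integral_cnj)
    finally show ?thesis unfolding eV by simp
  qed
  have i0: "integrable P (\<lambda>x. iexp (s * I x))" "integrable P (\<lambda>x. iexp (V x + s * I x))"
    "integrable P (\<lambda>x. iexp (- V x + s * I x))" for s
    by (auto intro!: int simp del: of_real_mult of_real_add of_real_minus)
  have cosV: "(1 + cos (V x)) *\<^sub>R iexp (s * I x) = iexp (s * I x) + (iexp (V x + s * I x) + iexp (- V x + s * I x)) / 2"
    and sinV: "(1 + sin (V x)) *\<^sub>R iexp (s * I x) = iexp (s * I x) + (iexp (V x + s * I x) - iexp (- V x + s * I x)) / (2 * \<i>)" for x s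
  proof -
    have "iexp (V x + s * I x) = iexp (V x) * iexp (s * I x)" "iexp (- V x + s * I x) = exp (- (\<i> * V x)) * iexp (s * I x)"
      by (simp_all add: exp_add[symmetric] exp_diff[symmetric] distrib_left right_diff_distrib)
    then show "(1 + cos (V x)) *\<^sub>R iexp (s * I x) = iexp (s * I x) + (iexp (V x + s * I x) + iexp (- V x + s * I x)) / 2"
      "(1 + sin (V x)) *\<^sub>R iexp (s * I x) = iexp (s * I x) + (iexp (V x + s * I x) - iexp (- V x + s * I x)) / (2 * \<i>)"
      by (simp_all add: scaleR_conv_of_real cos_exp_eq sin_exp_eq cos_of_real[symmetric] sin_of_real[symmetric]
          add_divide_distrib diff_divide_distrib ring_distribs mult.assoc)
  qed
  \<comment> \<open>Since \<open>V\<close> and \<open>- V\<close> give the same real constant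
    \<open>c\<close>, the cosine carries \<open>c\<close> and the sine contributes nothing. Under
    the weights \<open>1 + cos (V x)\<close> and \<open>1 + sin (V x)\<close> the variable
    \<open>I\<close> is therefore Gaussian with total mass \<open>1 + c\<close> and 1.\<close>
  have ecos: "(CLINT x|P. (1 + cos (V x)) *\<^sub>R iexp (s * I x)) = (1 + c) * exp (- (s * \<sigma>)\<^sup>2 / 2)" for s
    unfolding cosV using i0 eI eV eV' by (simp del: of_real_mult of_real_add of_real_minus, simp add: distrib_right)
  have esin: "(CLINT x|P. (1 + sin (V x)) *\<^sub>R iexp (s * I x)) = exp (- (s * \<sigma>)\<^sup>2 / 2)" for s
    unfolding sinV using i0 eI eV eV' by (simp del: of_real_mult of_real_add of_real_minus)
  let ?S = std_normal_distribution
  interpret S: prob_space ?S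
    using real_distribution.axioms(1)[OF real_dist_normal_dist] .
  have eS: "(CLINT x|?S. d *\<^sub>R iexp (s * (\<sigma> * x))) = d * exp (- (s * \<sigma>)\<^sup>2 / 2)" for s d
    using fun_cong[OF char_std_normal_distribution, of "s * \<sigma>"] by (simp add: char_def mult.assoc scaleR_conv_of_real)
  have mS: "(\<lambda>x. \<sigma> * x) \<in> borel_measurable ?S" by simp
  let ?z = "complex_of_real \<theta> + \<i> * a"
  define g where "g x = exp (?z * complex_of_real x)" for x :: real
  have g: "g \<in> borel_measurable borel" unfolding g_def by measurable
  have gS: "g (\<sigma> * x) = exp ((complex_of_real (\<theta> * \<sigma>) + \<i> * complex_of_real (a * \<sigma>)) * complex_of_real x)" for x
    by (simp add: g_def algebra_simps)
  have igS: "integrable ?S (\<lambda>x. d *\<^sub>R g (\<sigma> * x))" for d :: real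
    unfolding gS by (rule integrable_scaleR_right) (rule std_normal_exp)
  have G: "(CLINT x|?S. g (\<sigma> * x)) = exp (?z\<^sup>2 * \<sigma>\<^sup>2 / 2)"
    unfolding gS std_normal_exp(2) by (simp add: power_mult_distrib[symmetric] distrib_right mult.assoc)
  have pos: "0 \<le> 1 + cos x" "0 \<le> 1 + sin x" "0 \<le> 1 + c" for x :: real
    using c cos_ge_minus_one[of x] sin_ge_minus_one[of x] by linarith+
  have "\<bar>1 + cos x\<bar> \<le> 2" "\<bar>1 + sin x\<bar> \<le> 2" for x :: real
    using cos_le_one[of x] sin_le_one[of x] pos(1,2)[of x] by simp_all
  then have iw: "integrable P (\<lambda>x. 1 + cos (V x))" "integrable P (\<lambda>x. 1 + sin (V x))" "integrable P (\<lambda>x. 1::real)"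
    "integrable ?S (\<lambda>x. d::real)" for d
    by (auto intro!: int)
  \<comment> \<open>On the comparison side \<open>\<sigma>\<close> times a standard normal variable
    carries the constant weights 1, \<open>1 + c\<close> and 1; \<open>0 \<le> c\<close> makes the
    second one admissible. Each comparison transfers both the integral of \<open>g\<close> and its
    integrability.\<close>
  note R1 = weighted_char_determines_integral[OF I mS iw(3) zero_le_one iw(4)[of 1] zero_le_one _ g,
      unfolded scaleR_one, OF eI[THEN trans, OF eS[of 1, unfolded scaleR_one of_real_1 mult_1, symmetric]]]
  note R2 = weighted_char_determines_integral[OF I mS iw(1) pos(1) iw(4)[of "1 + c"] pos(3) _ g,
      OF ecos[THEN trans, OF eS[of "1 + c", symmetric]]]
  have esin': "(CLINT x|P. (1 + sin (V x)) *\<^sub>R iexp (s * I x)) = (CLINT x|?S. 1 *\<^sub>R iexp (s * (\<sigma> * x)))" for s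
    unfolding esin eS by simp
  note R3 = weighted_char_determines_integral[OF I mS iw(2) pos(2) iw(4)[of 1] zero_le_one esin' g]
  have ig: "integrable P (\<lambda>x. g (I x))" "integrable P (\<lambda>x. (1 + cos (V x)) *\<^sub>R g (I x))"
    "integrable P (\<lambda>x. (1 + sin (V x)) *\<^sub>R g (I x))"
    unfolding R1 R2 R3 using igS[of 1] igS[of "1 + c"] by auto
  \<comment> \<open>The shifts by 1 are undone here: \<open>iexp (V x)\<close> is
    \<open>cos (V x) + \<i> * sin (V x)\<close>, and each trigonometric term is a weighted
    expression minus the unweighted one.\<close>
  have "(CLINT x|P. iexp (V x + a * I x) * exp (\<theta> * I x)) =
     (CLINT x|P. ((1 + cos (V x)) *\<^sub>R g (I x) - g (I x)) + \<i> * ((1 + sin (V x)) *\<^sub>R g (I x) - g (I x)))"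
  proof (intro Bochner_Integration.integral_cong refl)
    fix x
    have "iexp (V x + a * I x) * exp (\<theta> * I x) = iexp (V x) * g (I x)"
      by (simp add: g_def exp_add[symmetric] exp_of_real[symmetric] algebra_simps del: exp_of_real)
    also have "iexp (V x) = cos (V x) + \<i> * sin (V x)"
      by (simp add: exp_Euler cos_of_real sin_of_real)
    finally show "iexp (V x + a * I x) * exp (\<theta> * I x) =
       ((1 + cos (V x)) *\<^sub>R g (I x) - g (I x)) + \<i> * ((1 + sin (V x)) *\<^sub>R g (I x) - g (I x))"
      by (simp add: scaleR_conv_of_real algebra_simps)
  qed
  also have "\<dots> = ((CLINT x|P. (1 + cos (V x)) *\<^sub>R g (I x)) - (CLINT x|P. g (I x)))
     + \<i> * ((CLINT x|P. (1 + sin (V x)) *\<^sub>R g (I x)) - (CLINT x|P. g (I x)))"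
    using ig by (simp only: Bochner_Integration.integral_add Bochner_Integration.integral_diff
      integral_mult_right_zero Bochner_Integration.integrable_diff integrable_mult_right)
  also have "\<dots> = c * exp (?z\<^sup>2 * \<sigma>\<^sup>2 / 2)"
    unfolding R1 R2 R3 integral_scaleR_right G by (simp add: scaleR_conv_of_real algebra_simps)
  finally show "(CLINT x|P. iexp (V x + a * I x) * exp (\<theta> * I x)) = c * exp (?z\<^sup>2 * \<sigma>\<^sup>2 / 2)" .
  have "norm (g y) = exp (\<theta> * y)" for y by (simp add: g_def)
  with integrable_norm[OF ig(1)] show "integrable P (\<lambda>x. exp (\<theta> * I x))" by simp
qed

subsection \<open>The quadratic form of a convolution kernel\<close>

text \<open>The covariance of the integrals of \<open>f\<close> and \<open>g\<close> against a
  process with covariance density \<open>k\<close>. Integration is over the whole plane: kernels on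
  \<open>{-T..T}\<close> and integrands on \<open>{0..T}\<close> are extended by zero before
  use.\<close>

definition conv_form :: "(real \<Rightarrow> real) \<Rightarrow> (real \<Rightarrow> real) \<Rightarrow> (real \<Rightarrow> real) \<Rightarrow> real" where
  "conv_form k f g = (\<integral>(u, v). f u * g v * k (u - v) \<partial>(lborel \<Otimes>\<^sub>M lborel))"

definition sq_integrable :: "(real \<Rightarrow> real) \<Rightarrow> bool" where
  "sq_integrable f \<longleftrightarrow> f \<in> borel_measurable borel \<and> integrable lborel (\<lambda>x. (f x)\<^sup>2)"

definition sq_norm :: "(real \<Rightarrow> real) \<Rightarrow> real" where
  "sq_norm f = (\<integral>x. (f x)\<^sup>2 \<partial>lborel)"

lemma sq_norm_nonneg: "0 \<le> sq_norm f"
  by (simp add: sq_norm_def)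

lemma sq_integrable_measurable[measurable_dest]: "sq_integrable f \<Longrightarrow> f \<in> borel_measurable borel"
  by (simp add: sq_integrable_def)

lemma integrable_sq_add:
  fixes f g :: "'a \<Rightarrow> real"
  assumes [measurable]: "f \<in> borel_measurable M" "g \<in> borel_measurable M"
    and "integrable M (\<lambda>x. (f x)\<^sup>2)" "integrable M (\<lambda>x. (g x)\<^sup>2)"
  shows "integrable M (\<lambda>x. (a * f x + b * g x)\<^sup>2)" "integrable M (\<lambda>x. f x * g x)"
proof -
  have int: "integrable M (\<lambda>x. 2 * (a\<^sup>2 * (f x)\<^sup>2 + b\<^sup>2 * (g x)\<^sup>2))" "integrable M (\<lambda>x. (f x)\<^sup>2 + (g x)\<^sup>2)"
    using assms by auto
  have "norm ((a * x + b * y)\<^sup>2) \<le> norm (2 * (a\<^sup>2 * x\<^sup>2 + b\<^sup>2 * y\<^sup>2))" for x y :: real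
  proof -
    have "(a * x + b * y)\<^sup>2 + (a * x - b * y)\<^sup>2 = 2 * (a\<^sup>2 * x\<^sup>2 + b\<^sup>2 * y\<^sup>2)"
      by (simp add: power2_eq_square algebra_simps)
    then show ?thesis
      unfolding real_norm_def
      using zero_le_power2[of "a * x - b * y"] zero_le_power2[of "a * x + b * y"] by linarith
  qed
  then show "integrable M (\<lambda>x. (a * f x + b * g x)\<^sup>2)"
    by (intro Bochner_Integration.integrable_bound[OF int(1)]) auto
  have "norm (x * y) \<le> norm (x\<^sup>2 + y\<^sup>2)" for x y :: real
  proof -
    have "2 * (\<bar>x\<bar> * \<bar>y\<bar>) \<le> x\<^sup>2 + y\<^sup>2"
      using sum_squares_bound[of "\<bar>x\<bar>" "\<bar>y\<bar>"] by simp
    moreover have "0 \<le> \<bar>x\<bar> * \<bar>y\<bar>" by simp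
    ultimately show ?thesis unfolding real_norm_def abs_mult by linarith
  qed
  then show "integrable M (\<lambda>x. f x * g x)"
    by (intro Bochner_Integration.integrable_bound[OF int(2)]) auto
qed

lemma sq_integrable_lin: "sq_integrable f \<Longrightarrow> sq_integrable g \<Longrightarrow> sq_integrable (\<lambda>x. a * f x + b * g x)"
  unfolding sq_integrable_def by (auto intro!: integrable_sq_add)

lemma sq_integrable_diff: "sq_integrable f \<Longrightarrow> sq_integrable g \<Longrightarrow> sq_integrable (\<lambda>x. f x - g x)"
  using sq_integrable_lin[of f g 1 "-1"] by simp

lemma sq_integrable_add_mult: "sq_integrable f \<Longrightarrow> sq_integrable g \<Longrightarrow> sq_integrable (\<lambda>x. f x + b * g x)"
  using sq_integrable_lin[of f g 1 b] by simp

text \<open>The price of squared norms is a factor 2: the right side minus the left side is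
  pointwise the square of \<open>f x - 2 * g x + h x\<close>.\<close>

lemma sq_norm_triangle:
  assumes f: "sq_integrable f" and g: "sq_integrable g" and h: "sq_integrable h"
  shows "sq_norm (\<lambda>x. f x - h x) \<le> 2 * sq_norm (\<lambda>x. f x - g x) + 2 * sq_norm (\<lambda>x. g x - h x)"
proof -
  have i: "integrable lborel (\<lambda>x. (f x - g x)\<^sup>2)" "integrable lborel (\<lambda>x. (g x - h x)\<^sup>2)" "integrable lborel (\<lambda>x. (f x - h x)\<^sup>2)"
    using sq_integrable_diff[OF f g] sq_integrable_diff[OF g h] sq_integrable_diff[OF f h]
    by (auto simp: sq_integrable_def)
  have *: "(a - c)\<^sup>2 \<le> 2 * (a - b)\<^sup>2 + 2 * (b - c)\<^sup>2" for a b c :: real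
    using zero_le_power2[of "a - 2 * b + c"] by (simp add: power2_eq_square algebra_simps)
  have "(\<integral>x. (f x - h x)\<^sup>2 \<partial>lborel) \<le> (\<integral>x. 2 * (f x - g x)\<^sup>2 + 2 * (g x - h x)\<^sup>2 \<partial>lborel)"
    using i by (intro integral_mono *) auto
  then show ?thesis using i by (simp add: sq_norm_def)
qed

lemma sq_norm_diff_commute: "sq_norm (\<lambda>x. f x - g x) = sq_norm (\<lambda>x. g x - f x)"
  by (simp add: sq_norm_def power2_commute)

lemma sq_integrable_zero: "sq_integrable (\<lambda>x. 0)"
  by (simp add: sq_integrable_def)

lemma sq_integrable_sum:
  "finite J \<Longrightarrow> (\<And>j. j \<in> J \<Longrightarrow> sq_integrable (f j)) \<Longrightarrow> sq_integrable (\<lambda>x. \<Sum>j\<in>J. c j * f j x)"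
proof (induction J rule: finite_induct)
  case (insert j J)
  then have "sq_integrable (\<lambda>x. c j * f j x + 1 * (\<Sum>j\<in>J. c j * f j x))"
    by (intro sq_integrable_lin) auto
  then show ?case using insert by simp
qed (simp add: sq_integrable_zero)

locale even_kernel =
  fixes k :: "real \<Rightarrow> real"
  assumes k_int: "integrable lborel k" and k_even: "\<And>u. k (- u) = k u"
begin

lemma k_measurable[measurable]: "k \<in> borel_measurable borel"
  using borel_measurable_integrable[OF k_int] by simp

definition \<kappa> :: real where "\<kappa> = (\<integral>u. \<bar>k u\<bar> \<partial>lborel)"

lemma \<kappa>_nonneg: "0 \<le> \<kappa>" by (simp add: \<kappa>_def)

lemma k_sym: "k (u - v) = k (v - u)"
  using k_even[of "u - v"] by simp

text \<open>Integrating out first the variable on which \<open>f\<close> does not depend leaves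
  \<kappa>, by translation invariance. Evenness of \<open>k\<close> lets the two variables be
  exchanged, which gives the second pair of claims.\<close>

lemma sq_kernel:
  assumes f: "sq_integrable f"
  shows "integrable (lborel \<Otimes>\<^sub>M lborel) (\<lambda>(u, v). (f u)\<^sup>2 * \<bar>k (u - v)\<bar>)"
    and "(\<integral>(u, v). (f u)\<^sup>2 * \<bar>k (u - v)\<bar> \<partial>(lborel \<Otimes>\<^sub>M lborel)) = \<kappa> * sq_norm f"
    and "integrable (lborel \<Otimes>\<^sub>M lborel) (\<lambda>(u, v). (f v)\<^sup>2 * \<bar>k (u - v)\<bar>)"
    and "(\<integral>(u, v). (f v)\<^sup>2 * \<bar>k (u - v)\<bar> \<partial>(lborel \<Otimes>\<^sub>M lborel)) = \<kappa> * sq_norm f"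
proof -
  note [measurable] = sq_integrable_measurable[OF f]
  have a: "integrable lborel (\<lambda>v. k (u - v))" for u
    using lborel_integrable_real_affine[OF k_int, of "-1" u] by simp
  have b: "(\<integral>v. \<bar>k (u - v)\<bar> \<partial>lborel) = \<kappa>" for u
    unfolding \<kappa>_def using lborel_integral_real_affine[of "-1" "\<lambda>x. \<bar>k x\<bar>" u] by simp
  have f2: "integrable lborel (\<lambda>u. (f u)\<^sup>2)" using f by (simp add: sq_integrable_def)
  show i: "integrable (lborel \<Otimes>\<^sub>M lborel) (\<lambda>(u, v). (f u)\<^sup>2 * \<bar>k (u - v)\<bar>)"
  proof (rule lborel_pair.Fubini_integrable)
    show "AE x in lborel. integrable lborel (\<lambda>y. case (x, y) of (u, v) \<Rightarrow> (f u)\<^sup>2 * \<bar>k (u - v)\<bar>)"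
      using a by auto
    show "integrable lborel (\<lambda>x. LINT y|lborel. norm (case (x, y) of (u, v) \<Rightarrow> (f u)\<^sup>2 * \<bar>k (u - v)\<bar>))"
      using f2 by (simp add: abs_mult b)
  qed measurable
  show e: "(\<integral>(u, v). (f u)\<^sup>2 * \<bar>k (u - v)\<bar> \<partial>(lborel \<Otimes>\<^sub>M lborel)) = \<kappa> * sq_norm f"
    using lborel_pair.integral_fst'[OF i] by (simp add: b sq_norm_def mult.commute)
  have sw: "(\<lambda>(x, y). (\<lambda>(u, v). (f u)\<^sup>2 * \<bar>k (u - v)\<bar>) (y, x)) = (\<lambda>(u, v). (f v)\<^sup>2 * \<bar>k (u - v)\<bar>)"
    by (auto simp: k_sym)
  show "integrable (lborel \<Otimes>\<^sub>M lborel) (\<lambda>(u, v). (f v)\<^sup>2 * \<bar>k (u - v)\<bar>)"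
    using lborel_pair.integrable_product_swap[OF i] unfolding sw .
  show "(\<integral>(u, v). (f v)\<^sup>2 * \<bar>k (u - v)\<bar> \<partial>(lborel \<Otimes>\<^sub>M lborel)) = \<kappa> * sq_norm f"
    using lborel_pair.integral_product_swap[OF borel_measurable_integrable[OF i]] unfolding sw e .
qed

text \<open>Young's inequality applied pointwise to \<open>f u * g v\<close>, with
  \<open>sq_kernel\<close> for the two squares. The parameter \<epsilon> stays free so that it can
  later be matched to the sizes of \<open>f\<close> and \<open>g\<close>.\<close>

lemma conv_form_bound:
  assumes f: "sq_integrable f" and g: "sq_integrable g"
  shows "integrable (lborel \<Otimes>\<^sub>M lborel) (\<lambda>(u, v). f u * g v * k (u - v))"
    and "\<epsilon> > 0 \<Longrightarrow> \<bar>conv_form k f g\<bar> \<le> \<kappa> * (\<epsilon> * sq_norm f + sq_norm g / \<epsilon>) / 2"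
proof -
  note [measurable] = sq_integrable_measurable[OF f] sq_integrable_measurable[OF g]
  define R where "R e = (\<lambda>(u, v). (e / 2) * ((f u)\<^sup>2 * \<bar>k (u - v)\<bar>) + (1 / (2 * e)) * ((g v)\<^sup>2 * \<bar>k (u - v)\<bar>))" for e
  have R': "R e = (\<lambda>z. (e / 2) * (case z of (u, v) \<Rightarrow> (f u)\<^sup>2 * \<bar>k (u - v)\<bar>) + (1 / (2 * e)) * (case z of (u, v) \<Rightarrow> (g v)\<^sup>2 * \<bar>k (u - v)\<bar>))" for e
    by (auto simp: R_def)
  have R: "integrable (lborel \<Otimes>\<^sub>M lborel) (R e)" for e
    unfolding R' by (intro Bochner_Integration.integrable_add integrable_mult_right sq_kernel f g)
  have le: "norm (case z of (u, v) \<Rightarrow> f u * g v * k (u - v)) \<le> R e z" if "e > 0" for e z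
  proof -
    have *: "\<bar>x * y\<bar> \<le> (e / 2) * x\<^sup>2 + (1 / (2 * e)) * y\<^sup>2" for x y :: real
    proof -
      have "0 \<le> (e * \<bar>x\<bar> - \<bar>y\<bar>)\<^sup>2 / (2 * e)" using that by simp
      also have "\<dots> = (e / 2) * x\<^sup>2 + (1 / (2 * e)) * y\<^sup>2 - \<bar>x * y\<bar>"
        using that by (simp add: power2_diff field_simps abs_mult power2_eq_square)
      finally show ?thesis by simp
    qed
    obtain u v where z: "z = (u, v)" by (cases z)
    have "\<bar>f u * g v\<bar> * \<bar>k (u - v)\<bar> \<le> ((e / 2) * (f u)\<^sup>2 + (1 / (2 * e)) * (g v)\<^sup>2) * \<bar>k (u - v)\<bar>"
      by (intro mult_right_mono *) auto
    then show ?thesis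
      by (simp add: z R_def abs_mult algebra_simps)
  qed
  show i: "integrable (lborel \<Otimes>\<^sub>M lborel) (\<lambda>(u, v). f u * g v * k (u - v))"
  proof (rule Bochner_Integration.integrable_bound[OF R[of 1]])
    show "AE x in lborel \<Otimes>\<^sub>M lborel. norm (case x of (u, v) \<Rightarrow> f u * g v * k (u - v)) \<le> norm (R 1 x)"
      by (intro AE_I2 order_trans[OF le[OF zero_less_one]]) simp
  qed measurable
  show "\<bar>conv_form k f g\<bar> \<le> \<kappa> * (\<epsilon> * sq_norm f + sq_norm g / \<epsilon>) / 2" if "\<epsilon> > 0"
  proof -
    have "\<bar>conv_form k f g\<bar> \<le> (\<integral>z. R \<epsilon> z \<partial>(lborel \<Otimes>\<^sub>M lborel))"
      unfolding conv_form_def real_norm_def[symmetric]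
      by (rule Bochner_Integration.integral_norm_bound_integral[OF i R le[OF that]])
    also have "\<dots> = (\<epsilon> / 2) * (\<kappa> * sq_norm f) + (1 / (2 * \<epsilon>)) * (\<kappa> * sq_norm g)"
      unfolding R' by (subst Bochner_Integration.integral_add)
        (auto intro!: integrable_mult_right sq_kernel f g simp: sq_kernel[OF f] sq_kernel[OF g])
    also have "\<dots> = \<kappa> * (\<epsilon> * sq_norm f + sq_norm g / \<epsilon>) / 2"
      using that by (simp add: field_simps)
    finally show ?thesis .
  qed
qed

lemma conv_form_diag_bound: "sq_integrable f \<Longrightarrow> \<bar>conv_form k f f\<bar> \<le> \<kappa> * sq_norm f"
  using conv_form_bound(2)[of f f 1] by simp

lemma conv_form_sym:
  assumes f: "sq_integrable f" and g: "sq_integrable g"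
  shows "conv_form k f g = conv_form k g f"
proof -
  have "(\<lambda>(x, y). (\<lambda>(u, v). f u * g v * k (u - v)) (y, x)) = (\<lambda>(u, v). g u * f v * k (u - v))"
    by (auto simp: k_sym mult_ac)
  then show ?thesis
    unfolding conv_form_def
    using lborel_pair.integral_product_swap[OF borel_measurable_integrable[OF conv_form_bound(1)[OF f g]]] by simp
qed

lemma conv_form_lin_left:
  assumes f: "sq_integrable f" and g: "sq_integrable g" and h: "sq_integrable h"
  shows "conv_form k (\<lambda>x. a * f x + b * g x) h = a * conv_form k f h + b * conv_form k g h"
proof -
  have "(\<lambda>(u, v). (a * f u + b * g u) * h v * k (u - v)) = (\<lambda>z. a * (case z of (u, v) \<Rightarrow> f u * h v * k (u - v))
     + b * (case z of (u, v) \<Rightarrow> g u * h v * k (u - v)))"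
    by (auto simp: algebra_simps)
  then show ?thesis
    unfolding conv_form_def
    using conv_form_bound(1)[OF f h] conv_form_bound(1)[OF g h]
    by (simp add: Bochner_Integration.integral_add)
qed

lemma conv_form_zero: "conv_form k (\<lambda>x. 0) h = 0" "conv_form k h (\<lambda>x. 0) = 0"
  by (simp_all add: conv_form_def case_prod_beta cong: Bochner_Integration.integral_cong)

lemma conv_form_sum_left:
  assumes "finite J" "\<And>j. j \<in> J \<Longrightarrow> sq_integrable (f j)" and h: "sq_integrable h"
  shows "conv_form k (\<lambda>x. \<Sum>j\<in>J. c j * f j x) h = (\<Sum>j\<in>J. c j * conv_form k (f j) h)"
  using assms(1,2)
proof (induction J rule: finite_induct)
  case (insert j J)
  have "conv_form k (\<lambda>x. c j * f j x + 1 * (\<Sum>j\<in>J. c j * f j x)) h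
     = c j * conv_form k (f j) h + 1 * conv_form k (\<lambda>x. \<Sum>j\<in>J. c j * f j x) h"
    using insert by (intro conv_form_lin_left h sq_integrable_sum) auto
  then show ?case using insert by simp
qed (simp add: conv_form_zero)

lemma conv_form_sum_right:
  assumes "finite J" "\<And>j. j \<in> J \<Longrightarrow> sq_integrable (f j)" and h: "sq_integrable h"
  shows "conv_form k h (\<lambda>x. \<Sum>j\<in>J. c j * f j x) = (\<Sum>j\<in>J. c j * conv_form k h (f j))"
  using assms conv_form_sum_left[OF assms]
  by (simp add: conv_form_sym[OF h] sq_integrable_sum)

lemma conv_form_quadratic:
  assumes f: "sq_integrable f" and g: "sq_integrable g"
  shows "conv_form k (\<lambda>x. f x + s * g x) (\<lambda>x. f x + s * g x)
    = conv_form k f f + 2 * s * conv_form k f g + s\<^sup>2 * conv_form k g g"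
proof -
  let ?h = "\<lambda>x. f x + s * g x"
  have h: "sq_integrable ?h" by (rule sq_integrable_add_mult[OF f g])
  have l: "conv_form k ?h w = conv_form k f w + s * conv_form k g w" if "sq_integrable w" for w
    using conv_form_lin_left[OF f g that, of 1 s] by simp
  have r: "conv_form k w ?h = conv_form k w f + s * conv_form k w g" if w: "sq_integrable w" for w
    using l[OF w] conv_form_sym[OF w] f g h by simp
  show ?thesis
    using l[OF h] r[OF f] r[OF g] conv_form_sym[OF f g] by (simp add: power2_eq_square algebra_simps)
qed

text \<open>The quadratic form is expanded around \<open>f\<close>. The diagonal error is controlled
  by the squared norm directly; the cross term needs a value of \<epsilon> that tends to zero with
  \<open>n\<close>.\<close>

lemma conv_form_tendsto:
  assumes f: "sq_integrable f" and g: "\<And>n. sq_integrable (g n)"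
    and lim: "(\<lambda>n. sq_norm (\<lambda>x. g n x - f x)) \<longlonglongrightarrow> 0"
  shows "(\<lambda>n. conv_form k (g n) (g n)) \<longlonglongrightarrow> conv_form k f f"
proof -
  define d where "d n x = g n x - f x" for n x
  have d: "sq_integrable (d n)" for n unfolding d_def by (intro sq_integrable_diff f g)
  have eq: "conv_form k (g n) (g n) = conv_form k f f + 2 * conv_form k f (d n) + conv_form k (d n) (d n)" for n
    using conv_form_quadratic[OF f d, of 1 n] by (simp add: d_def)
  have lim': "(\<lambda>n. sq_norm (d n)) \<longlonglongrightarrow> 0" using lim unfolding d_def .
  have dd: "(\<lambda>n. conv_form k (d n) (d n)) \<longlonglongrightarrow> 0"
  proof (rule Lim_null_comparison)
    show "(\<lambda>n. \<kappa> * sq_norm (d n)) \<longlonglongrightarrow> 0" using tendsto_mult_right_zero[OF lim'] .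
  qed (auto simp: conv_form_diag_bound d)
  have fd: "(\<lambda>n. conv_form k f (d n)) \<longlonglongrightarrow> 0"
  proof (rule Lim_null_comparison)
    \<comment> \<open>The norm of \<open>d n\<close> is the value that makes both terms of Young's
      bound vanish in the limit; the summand \<open>1 / real (Suc n)\<close> keeps it positive when
      \<open>d n\<close> is a null function.\<close>
    let ?e = "\<lambda>n. sqrt (sq_norm (d n)) + 1 / real (Suc n)"
    have e0: "(\<lambda>n. ?e n) \<longlonglongrightarrow> 0"
      using tendsto_add[OF tendsto_real_sqrt[OF lim'] LIMSEQ_inverse_real_of_nat] by (simp add: inverse_eq_divide)
    show "(\<lambda>n. \<kappa> * (?e n * sq_norm f + ?e n) / 2) \<longlonglongrightarrow> 0"
      using tendsto_mult_right_zero[OF tendsto_add_zero[OF tendsto_mult_left_zero[OF e0, of "sq_norm f"] e0], of "\<kappa>/2"] by simp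
    show "\<forall>\<^sub>F n in sequentially. norm (conv_form k f (d n)) \<le> \<kappa> * (?e n * sq_norm f + ?e n) / 2"
    proof (intro always_eventually allI)
      fix n
      have e: "?e n > 0" by (intro add_nonneg_pos) (auto simp: sq_norm_nonneg)
      have "sq_norm (d n) = (sqrt (sq_norm (d n)))\<^sup>2" by (simp add: sq_norm_nonneg)
      also have "\<dots> \<le> (?e n)\<^sup>2" by (intro power_mono) (auto simp: sq_norm_nonneg)
      finally have "sq_norm (d n) / ?e n \<le> ?e n" using e by (simp add: divide_le_eq power2_eq_square)
      then have "\<kappa> * (?e n * sq_norm f + sq_norm (d n) / ?e n) / 2 \<le> \<kappa> * (?e n * sq_norm f + ?e n) / 2"
        by (intro divide_right_mono mult_left_mono \<kappa>_nonneg) auto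
      with conv_form_bound(2)[OF f d e, of n] show "norm (conv_form k f (d n)) \<le> \<kappa> * (?e n * sq_norm f + ?e n) / 2"
        by simp
    qed
  qed
  show ?thesis
    unfolding eq using tendsto_add[OF tendsto_add[OF tendsto_const tendsto_mult_right_zero[OF fd]] dd, of "conv_form k f f" 2] by simp
qed

end

subsection \<open>Density of step functions\<close>

lemma partition_mono: "is_partition T n p \<Longrightarrow> i \<le> j \<Longrightarrow> j \<le> n \<Longrightarrow> p i \<le> p j"
proof (induction j)
  case (Suc j)
  have "p j < p (Suc j)" using Suc.prems by (simp add: is_partition_def)
  with Suc show ?case by (cases "i = Suc j") auto
qed simp

lemma partition_range: "is_partition T n p \<Longrightarrow> i \<le> n \<Longrightarrow> p i \<in> {0..T}"
  using partition_mono[of T n p 0 i] partition_mono[of T n p i n] by (simp add: is_partition_def)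

lemma partition_cell:
  fixes p :: "nat \<Rightarrow> real"
  shows "p 0 < s \<Longrightarrow> s \<le> p n \<Longrightarrow> \<exists>i<n. p i < s \<and> s \<le> p (Suc i)"
proof (induction n)
  case (Suc n)
  then show ?case by (cases "s \<le> p n") (auto intro: less_SucI)
qed simp

lemma step_fun_eq:
  assumes p: "is_partition T n p" and i: "i < n" and s: "p i < s" "s \<le> p (Suc i)"
  shows "step_fun n p c s = c i"
proof -
  have "c j * indicator {p j<..p (Suc j)} s = (if j = i then c i else 0)" if "j < n" for j
  proof (cases j i rule: linorder_cases)
    case less
    then have "p (Suc j) \<le> p i" using i by (intro partition_mono[OF p]) auto
    then show ?thesis using s less by auto
  next
    case greater
    then have "p (Suc i) \<le> p j" using that by (intro partition_mono[OF p]) auto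
    then show ?thesis using s greater by auto
  qed (use s in auto)
  then have "step_fun n p c s = (\<Sum>j<n. if j = i then c i else 0)"
    unfolding step_fun_def by (intro sum.cong) auto
  then show ?thesis using i by simp
qed

lemma step_fun_outside:
  assumes p: "is_partition T n p" and s: "s \<notin> {0<..T}"
  shows "step_fun n p c s = 0"
proof -
  have "s \<notin> {p j<..p (Suc j)}" if "j < n" for j
    using partition_range[OF p, of j] partition_range[OF p, of "Suc j"] that s by auto
  then show ?thesis by (auto simp: step_fun_def intro!: sum.neutral)
qed

lemma sq_integrable_indicator: "sq_integrable (indicator {a<..b::real})"
proof -
  have "(\<lambda>x. (indicator {a<..b} x)\<^sup>2 :: real) = indicator {a<..b}"
    by (auto simp: indicator_def)
  then show ?thesis
    by (cases "a \<le> b") (auto simp: sq_integrable_def)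
qed

lemma sq_integrable_step_fun: "sq_integrable (step_fun n p c)"
  unfolding step_fun_def[abs_def] by (intro sq_integrable_sum sq_integrable_indicator) auto

lemma continuous_uniform_step_approx:
  fixes g :: "real \<Rightarrow> real"
  assumes g: "continuous_on UNIV g" and T: "T > 0" and e: "e > 0"
  shows "\<exists>n p c. is_partition T n p \<and> (\<forall>s\<in>{0<..T}. \<bar>step_fun n p c s - g s\<bar> \<le> e)"
proof -
  have "uniformly_continuous_on {0..T} g"
    by (intro compact_uniformly_continuous continuous_on_subset[OF g]) auto
  then obtain d where d: "d > 0" "\<And>x y. x \<in> {0..T} \<Longrightarrow> y \<in> {0..T} \<Longrightarrow> dist x y < d \<Longrightarrow> dist (g x) (g y) < e"
    unfolding uniformly_continuous_on_def using e by metis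
  obtain n where n: "T / d < real n" using reals_Archimedean2 by blast
  then have n0: "n > 0" using T d by (cases n) (auto simp: field_simps)
  define p where "p i = real i * T / real n" for i
  have p: "is_partition T n p"
    using n0 T by (auto simp: is_partition_def p_def field_simps)
  have w: "p (Suc i) - p i < d" for i
    using n n0 d by (simp add: p_def field_simps)
  have "\<bar>step_fun n p (\<lambda>i. g (p i)) s - g s\<bar> \<le> e" if s: "s \<in> {0<..T}" for s
  proof -
    obtain i where i: "i < n" "p i < s" "s \<le> p (Suc i)"
      using partition_cell[of p s n] s p by (auto simp: is_partition_def)
    have "dist (p i) s < d" using w[of i] i by (simp add: dist_real_def)
    then have "dist (g (p i)) (g s) < e"
      using d(2)[of "p i" s] partition_range[OF p, of i] i s by auto
    then show ?thesis
      unfolding step_fun_eq[OF p i] by (simp add: dist_real_def)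
  qed
  with p show ?thesis by blast
qed

text \<open>Three approximations are chained: \<open>f\<close> by its truncation at height
  \<open>K\<close>, the truncation by truncated continuous functions cut to \<open>{0..T}\<close>,
  and one of these uniformly by a step function. Continuous functions converging to \<open>f\<close>
  almost everywhere exist by measurability alone; truncating them supplies the bound needed for
  dominated convergence.\<close>

lemma step_fun_dense:
  assumes f: "sq_integrable f" and f0: "\<And>s. s \<notin> {0..T} \<Longrightarrow> f s = 0" and T: "T > 0" and e: "e > 0"
  shows "\<exists>n p c. is_partition T n p \<and> sq_norm (\<lambda>s. step_fun n p c s - f s) < e"
proof -
  note [measurable] = sq_integrable_measurable[OF f]
  have "f \<in> borel_measurable lebesgue" using measurable_completion[of f lborel borel] by simp
  then have "f measurable_on UNIV"
    by (intro lebesgue_measurable_imp_measurable_on_real) auto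
  then obtain N g where N: "negligible N" and g: "\<And>n. continuous_on UNIV (g n)"
    and lim: "\<And>x. x \<notin> N \<Longrightarrow> (\<lambda>n. g n x) \<longlonglongrightarrow> f x"
    unfolding measurable_on_def by auto
  have gm[measurable]: "g n \<in> borel_measurable borel" for n
    using g by (rule borel_measurable_continuous_onI)
  have "AE x in lebesgue. x \<notin> N"
    using N unfolding negligible_iff_null_sets by (rule AE_not_in)
  then have AEN: "AE x in lborel. x \<notin> N" by (simp add: AE_completion_iff)
  define cl where "cl K x = max (- K) (min K x)" for K x :: real
  have cl_cont: "continuous_on UNIV (cl K)" for K
    unfolding cl_def by (intro continuous_intros)
  have cl_m[measurable]: "cl K \<in> borel_measurable borel" for K
    using cl_cont by (rule borel_measurable_continuous_onI)
  have cl_b: "\<bar>cl K x\<bar> \<le> K" if "K \<ge> 0" for K x using that by (auto simp: cl_def)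
  have f2: "integrable lborel (\<lambda>x. (f x)\<^sup>2)" using f by (simp add: sq_integrable_def)
  have fin: "integrable lborel (\<lambda>x. b * indicator {0..T} x :: real)" for b :: real
    using T by (intro integrable_mult_right) auto
  have "(\<lambda>K. \<integral>x. (cl (real K) (f x) - f x)\<^sup>2 \<partial>lborel) \<longlonglongrightarrow> (\<integral>x. 0 \<partial>(lborel :: real measure))"
  proof (rule integral_dominated_convergence[where w = "\<lambda>x. (f x)\<^sup>2"])
    show "AE x in lborel. (\<lambda>K. (cl (real K) (f x) - f x)\<^sup>2) \<longlonglongrightarrow> 0"
    proof (intro AE_I2 tendsto_eventually)
      fix x
      obtain K0 where "\<bar>f x\<bar> < real K0" using reals_Archimedean2 by blast
      then show "\<forall>\<^sub>F K in sequentially. (cl (real K) (f x) - f x)\<^sup>2 = 0"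
        by (intro eventually_sequentiallyI[of K0]) (auto simp: cl_def)
    qed
    show "AE x in lborel. norm ((cl (real K) (f x) - f x)\<^sup>2) \<le> (f x)\<^sup>2" for K
      by (intro AE_I2) (auto simp: cl_def max_def min_def abs_le_square_iff[symmetric])
  qed (auto intro: f2)
  \<comment> \<open>The error budget: with truncation error \<open>e / 8\<close> and two further
    errors \<open>e / 16\<close>, two uses of \<open>sq_norm_triangle\<close> give at most
    \<open>2 * (e / 4) + 2 * (e / 8) < e\<close>.\<close>
  then have "\<forall>\<^sub>F K in sequentially. sq_norm (\<lambda>x. cl (real K) (f x) - f x) < e / 8"
    using e by (intro order_tendstoD(2)[where y = 0]) (auto simp: sq_norm_def)
  then obtain K :: nat where K: "sq_norm (\<lambda>x. cl (real K) (f x) - f x) < e / 8"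
    by (auto simp: eventually_sequentially)
  define G where "G n x = indicator {0..T} x * cl (real K) (g n x)" for n x
  have Gm[measurable]: "G n \<in> borel_measurable borel" for n unfolding G_def by measurable
  have clf: "cl (real K) (f x) = indicator {0..T} x * cl (real K) (f x)" for x
    using f0[of x] by (cases "x \<in> {0..T}") (auto simp: cl_def)
  have sqb: "(indicator {0..T} x * cl (real K) y - indicator {0..T} x * cl (real K) z)\<^sup>2 \<le> (2 * real K)\<^sup>2 * indicator {0..T} x" for x y z
  proof -
    have "\<bar>cl (real K) y - cl (real K) z\<bar> \<le> \<bar>2 * real K\<bar>"
      using cl_b[of "real K" y] cl_b[of "real K" z] by linarith
    then have "(cl (real K) y - cl (real K) z)\<^sup>2 \<le> (2 * real K)\<^sup>2"
      unfolding abs_le_square_iff .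
    then show ?thesis by (simp add: indicator_def)
  qed
  have G: "sq_integrable (G n)" for n
    unfolding sq_integrable_def
  proof (intro conjI Gm Bochner_Integration.integrable_bound[OF fin[of "(2 * real K)\<^sup>2"]])
    show "AE x in lborel. norm ((G n x)\<^sup>2) \<le> norm ((2 * real K)\<^sup>2 * indicator {0..T} x)"
      using sqb[of _ "g n _" 0] by (auto simp: G_def cl_def)
  qed auto
  have F: "sq_integrable (\<lambda>x. cl (real K) (f x))"
    unfolding sq_integrable_def
  proof (intro conjI Bochner_Integration.integrable_bound[OF fin[of "(2 * real K)\<^sup>2"]])
    show "AE x in lborel. norm ((cl (real K) (f x))\<^sup>2) \<le> norm ((2 * real K)\<^sup>2 * indicator {0..T} x)"
    proof (intro AE_I2)
      fix x
      show "norm ((cl (real K) (f x))\<^sup>2) \<le> norm ((2 * real K)\<^sup>2 * indicator {0..T} x)"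
        using sqb[of x "f x" 0] unfolding clf[symmetric] by (simp add: cl_def)
    qed
  qed auto
  have "(\<lambda>n. \<integral>x. (G n x - cl (real K) (f x))\<^sup>2 \<partial>lborel) \<longlonglongrightarrow> (\<integral>x. 0 \<partial>(lborel :: real measure))"
  proof (rule integral_dominated_convergence[where w = "\<lambda>x. (2 * real K)\<^sup>2 * indicator {0..T} x"])
    show "AE x in lborel. (\<lambda>n. (G n x - cl (real K) (f x))\<^sup>2) \<longlonglongrightarrow> 0"
      using AEN
    proof eventually_elim
      case (elim x)
      have "(\<lambda>n. cl (real K) (g n x)) \<longlonglongrightarrow> cl (real K) (f x)"
        unfolding cl_def by (intro tendsto_intros lim elim)
      then have "(\<lambda>n. G n x - cl (real K) (f x)) \<longlonglongrightarrow> indicator {0..T} x * cl (real K) (f x) - cl (real K) (f x)"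
        unfolding G_def by (intro tendsto_intros)
      then have "(\<lambda>n. (G n x - cl (real K) (f x))\<^sup>2) \<longlonglongrightarrow> 0\<^sup>2"
        unfolding clf[symmetric] by (intro tendsto_power) simp
      then show ?case by simp
    qed
    show "AE x in lborel. norm ((G n x - cl (real K) (f x))\<^sup>2) \<le> (2 * real K)\<^sup>2 * indicator {0..T} x" for n
    proof (intro AE_I2)
      fix x
      show "norm ((G n x - cl (real K) (f x))\<^sup>2) \<le> (2 * real K)\<^sup>2 * indicator {0..T} x"
        using sqb[of x "g n x" "f x"] unfolding clf[symmetric] G_def by simp
    qed
    show "integrable lborel (\<lambda>x. (2 * real K)\<^sup>2 * indicator {0..T} x)" by (rule fin)
  qed auto
  then have "\<forall>\<^sub>F n in sequentially. sq_norm (\<lambda>x. G n x - cl (real K) (f x)) < e / 16"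
    using e by (intro order_tendstoD(2)[where y = 0]) (auto simp: sq_norm_def)
  then obtain m where m: "sq_norm (\<lambda>x. G m x - cl (real K) (f x)) < e / 16"
    by (auto simp: eventually_sequentially)
  \<comment> \<open>A uniform error \<epsilon> on an interval of length \<open>T\<close> costs
    \<open>\<epsilon>\<^sup>2 * T\<close> in squared norm.\<close>
  define \<epsilon> where "\<epsilon> = sqrt (e / (16 * T))"
  have \<epsilon>: "\<epsilon> > 0" "\<epsilon>\<^sup>2 * T = e / 16" using e T by (auto simp: \<epsilon>_def)
  have "continuous_on UNIV (\<lambda>x. cl (real K) (g m x))"
    by (rule continuous_on_compose2[OF cl_cont g]) auto
  then obtain n p c where p: "is_partition T n p"
    and s: "\<And>s. s \<in> {0<..T} \<Longrightarrow> \<bar>step_fun n p c s - cl (real K) (g m s)\<bar> \<le> \<epsilon>"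
    using continuous_uniform_step_approx[OF _ T \<epsilon>(1)] by blast
  note S = sq_integrable_step_fun[of n p c]
  \<comment> \<open>The point 0 is left out: cells are open on the left, so step functions vanish
    there while \<open>G m\<close> need not.\<close>
  have "AE x in lborel. (step_fun n p c x - G m x)\<^sup>2 \<le> \<epsilon>\<^sup>2 * indicator {0..T} x"
    using AE_lborel_singleton[of 0]
  proof eventually_elim
    case (elim x)
    show ?case
    proof (cases "x \<in> {0<..T}")
      case True
      then show ?thesis using s[OF True] \<epsilon> by (auto simp: G_def abs_le_square_iff[symmetric])
    next
      case False
      then show ?thesis using elim step_fun_outside[OF p False] by (auto simp: G_def indicator_def)
    qed
  qed
  then have "sq_norm (\<lambda>x. step_fun n p c x - G m x) \<le> (\<integral>x. \<epsilon>\<^sup>2 * indicator {0..T} x \<partial>lborel)"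
    unfolding sq_norm_def using sq_integrable_diff[OF S G]
    by (intro integral_mono_AE fin) (auto simp: sq_integrable_def)
  also have "\<dots> = e / 16" using T \<epsilon> by simp
  finally have 1: "sq_norm (\<lambda>x. step_fun n p c x - G m x) \<le> e / 16" .
  have "sq_norm (\<lambda>x. step_fun n p c x - f x) < e"
    using sq_norm_triangle[OF S G F, of m] sq_norm_triangle[OF S F f] 1 m K e by linarith
  with p show ?thesis by blast
qed

subsection \<open>The mean-square integral\<close>

text \<open>The map \<open>iexp\<close> is 1-Lipschitz, and
  \<open>d \<le> \<epsilon> + d\<^sup>2 / \<epsilon>\<close> for nonnegative \<open>d\<close> bounds
  the mean of \<open>d\<close> by its second moment.\<close>

lemma (in prob_space) iexp_tendsto_of_L2:
  fixes Z I :: "'a \<Rightarrow> real" and S :: "nat \<Rightarrow> 'a \<Rightarrow> real"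
  assumes [measurable]: "Z \<in> borel_measurable M" "I \<in> borel_measurable M" "\<And>n. S n \<in> borel_measurable M"
    and lim: "(\<lambda>n. \<integral>\<^sup>+x. ennreal ((S n x - I x)\<^sup>2) \<partial>M) \<longlonglongrightarrow> 0"
  shows "(\<lambda>n. CLINT x|M. iexp (Z x + s * S n x)) \<longlonglongrightarrow> (CLINT x|M. iexp (Z x + s * I x))"
proof (rule tendstoI)
  fix e :: real assume e: "e > 0"
  \<comment> \<open>The final bound is \<open>\<bar>s\<bar> * (\<epsilon> + \<epsilon>)\<close>,
    hence at most \<open>e / 2\<close>; adding 1 to \<open>\<bar>s\<bar>\<close> covers
    \<open>s = 0\<close>.\<close>
  define \<epsilon> where "\<epsilon> = e / (4 * (\<bar>s\<bar> + 1))"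
  have \<epsilon>: "\<epsilon> > 0" using e by (auto simp: \<epsilon>_def)
  have "\<bar>s\<bar> * \<epsilon> \<le> (\<bar>s\<bar> + 1) * \<epsilon>" using \<epsilon> by (intro mult_right_mono) auto
  also have "\<dots> = e / 4" using e by (simp add: \<epsilon>_def field_simps)
  finally have s\<epsilon>: "\<bar>s\<bar> * \<epsilon> \<le> e / 4" .
  have "\<forall>\<^sub>F n in sequentially. (\<integral>\<^sup>+x. ennreal ((S n x - I x)\<^sup>2) \<partial>M) < ennreal (\<epsilon>\<^sup>2)"
    using \<epsilon> by (intro order_tendstoD(2)[OF lim]) auto
  then show "\<forall>\<^sub>F n in sequentially. dist (CLINT x|M. iexp (Z x + s * S n x)) (CLINT x|M. iexp (Z x + s * I x)) < e"
  proof eventually_elim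
    case (elim n)
    have i: "integrable M (\<lambda>x. (S n x - I x)\<^sup>2)"
      using elim by (intro integrableI_nonneg) (auto intro: less_trans ennreal_less_top)
    have le: "(\<integral>x. (S n x - I x)\<^sup>2 \<partial>M) \<le> \<epsilon>\<^sup>2"
    proof -
      have "(\<integral>\<^sup>+x. ennreal ((S n x - I x)\<^sup>2) \<partial>M) = ennreal (\<integral>x. (S n x - I x)\<^sup>2 \<partial>M)"
        by (rule nn_integral_eq_integral[OF i]) auto
      then show ?thesis using elim by (simp add: ennreal_less_iff)
    qed
    have j: "complex_integrable M (\<lambda>x. iexp (Z x + s * J x))" if [measurable]: "J \<in> borel_measurable M" for J
      by (intro integrable_const_bound[where B = 1]) (auto simp del: of_real_add of_real_mult)
    have b: "norm (iexp (Z x + s * S n x) - iexp (Z x + s * I x)) \<le> \<bar>s\<bar> * (\<epsilon> + (S n x - I x)\<^sup>2 / \<epsilon>)" for x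
    proof -
      have "iexp (Z x + s * S n x) - iexp (Z x + s * I x) = iexp (Z x + s * I x) * (iexp (s * (S n x - I x)) - 1)"
        by (simp add: exp_add[symmetric] algebra_simps)
      then have "norm (iexp (Z x + s * S n x) - iexp (Z x + s * I x)) = norm (iexp (s * (S n x - I x)) - 1)"
        by (simp add: norm_mult del: of_real_add of_real_mult of_real_diff)
      also have "\<dots> \<le> \<bar>s * (S n x - I x)\<bar>"
        using iexp_approx1[of "s * (S n x - I x)" 0] by simp
      also have "\<dots> \<le> \<bar>s\<bar> * (\<epsilon> + (S n x - I x)\<^sup>2 / \<epsilon>)"
        unfolding abs_mult
      proof (rule mult_left_mono)
        let ?d = "\<bar>S n x - I x\<bar>"
        have "\<epsilon> * ?d \<le> \<epsilon>\<^sup>2 + ?d\<^sup>2"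
        proof -
          have "2 * \<epsilon> * ?d \<le> \<epsilon>\<^sup>2 + ?d\<^sup>2" by (rule sum_squares_bound)
          moreover have "0 \<le> \<epsilon> * ?d" using \<epsilon> by simp
          ultimately show ?thesis by linarith
        qed
        then show "?d \<le> \<epsilon> + (S n x - I x)\<^sup>2 / \<epsilon>"
          using \<epsilon> by (simp add: field_simps power2_eq_square)
      qed simp
      finally show ?thesis .
    qed
    have "dist (CLINT x|M. iexp (Z x + s * S n x)) (CLINT x|M. iexp (Z x + s * I x))
       = norm (CLINT x|M. iexp (Z x + s * S n x) - iexp (Z x + s * I x))"
      using j by (simp add: dist_norm del: of_real_add of_real_mult)
    also have "\<dots> \<le> (\<integral>x. \<bar>s\<bar> * (\<epsilon> + (S n x - I x)\<^sup>2 / \<epsilon>) \<partial>M)"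
    proof -
      have d: "integrable M (\<lambda>x. iexp (Z x + s * S n x) - iexp (Z x + s * I x))"
        by (intro Bochner_Integration.integrable_diff j) auto
      show ?thesis
        by (rule order_trans[OF integral_norm_bound integral_mono[OF integrable_norm[OF d] _ b]]) (use i in simp)
    qed
    also have "\<dots> = \<bar>s\<bar> * (\<epsilon> + (\<integral>x. (S n x - I x)\<^sup>2 \<partial>M) / \<epsilon>)"
      using i by (simp add: prob_space)
    also have "\<dots> \<le> \<bar>s\<bar> * (\<epsilon> + \<epsilon>)"
      using le \<epsilon> by (intro mult_left_mono add_left_mono) (auto simp: divide_le_eq power2_eq_square)
    also have "\<dots> < e" using s\<epsilon> e by (simp add: distrib_left)
    finally show ?case .
  qed
qed

text \<open>Gaussianity is recorded as the form of the characteristic functions of linear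
  combinations, which is what survives mean-square limits. The process lives on an abstract
  probability space, so that the coordinate process under its own law can be inserted.\<close>

locale integrated_kernel_process = even_kernel k + prob_space P
  for k :: "real \<Rightarrow> real" and P :: "'p measure" +
  fixes Y :: "real \<Rightarrow> 'p \<Rightarrow> real" and T :: real
  assumes T_pos: "T > 0"
    and Y_measurable: "\<And>t. t \<in> {0..T} \<Longrightarrow> Y t \<in> borel_measurable P"
    and Y_sq: "\<And>t. t \<in> {0..T} \<Longrightarrow> integrable P (\<lambda>x. (Y t x)\<^sup>2)"
    and Y_cov: "\<And>s t. s \<in> {0..T} \<Longrightarrow> t \<in> {0..T} \<Longrightarrow>
      (\<integral>x. Y t x * Y s x \<partial>P) = conv_form k (indicator {0<..t}) (indicator {0<..s})"
    and Y_char: "\<And>J c. finite J \<Longrightarrow> J \<subseteq> {0..T} \<Longrightarrow>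
      (CLINT x|P. iexp (\<Sum>t\<in>J. c t * Y t x)) = exp (- (\<integral>x. (\<Sum>t\<in>J. c t * Y t x)\<^sup>2 \<partial>P) / 2)"
begin

text \<open>\<open>represents Z f\<close>: the finite linear combination \<open>Z\<close> of values of the process is the
  integral of the step function \<open>f\<close>.\<close>
definition represents :: "('p \<Rightarrow> real) \<Rightarrow> (real \<Rightarrow> real) \<Rightarrow> bool" where
  "represents Z f \<longleftrightarrow> (\<exists>J c. finite J \<and> J \<subseteq> {0..T} \<and> Z = (\<lambda>x. \<Sum>t\<in>J. c t * Y t x) \<and>
     f = (\<lambda>s. \<Sum>t\<in>J. c t * indicator {0<..t} s))"

lemma represents_value: "t \<in> {0..T} \<Longrightarrow> represents (Y t) (indicator {0<..t})"
  unfolding represents_def by (intro exI[of _ "{t}"] exI[of _ "\<lambda>_. 1"]) auto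

lemma represents_lin:
  assumes "represents Z f" "represents Z' f'"
  shows "represents (\<lambda>x. a * Z x + b * Z' x) (\<lambda>s. a * f s + b * f' s)"
proof -
  obtain J c where J: "finite J" "J \<subseteq> {0..T}" "Z = (\<lambda>x. \<Sum>t\<in>J. c t * Y t x)" "f = (\<lambda>s. \<Sum>t\<in>J. c t * indicator {0<..t} s)"
    using assms(1) by (auto simp: represents_def)
  obtain J' c' where J': "finite J'" "J' \<subseteq> {0..T}" "Z' = (\<lambda>x. \<Sum>t\<in>J'. c' t * Y t x)" "f' = (\<lambda>s. \<Sum>t\<in>J'. c' t * indicator {0<..t} s)"
    using assms(2) by (auto simp: represents_def)
  define d where "d t = a * (if t \<in> J then c t else 0) + b * (if t \<in> J' then c' t else 0)" for t
  have "(\<Sum>t\<in>J \<union> J'. d t * y t) = a * (\<Sum>t\<in>J. c t * y t) + b * (\<Sum>t\<in>J'. c' t * y t)" for y :: "real \<Rightarrow> real"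
  proof -
    have "(\<Sum>t\<in>J \<union> J'. (if t \<in> J then c t else 0) * y t) = (\<Sum>t\<in>J. c t * y t)"
      "(\<Sum>t\<in>J \<union> J'. (if t \<in> J' then c' t else 0) * y t) = (\<Sum>t\<in>J'. c' t * y t)"
      using J(1) J'(1) by (auto intro!: sum.mono_neutral_cong_right)
    then show ?thesis
      by (simp add: d_def distrib_right sum.distrib mult.assoc sum_distrib_left[symmetric])
  qed
  then show ?thesis
    unfolding represents_def using J J' by (intro exI[of _ "J \<union> J'"] exI[of _ d]) auto
qed

lemma represents_step:
  assumes p: "is_partition T n p"
  shows "represents (step_int Y n p c) (step_fun n p c)"
proof -
  have "m \<le> n \<Longrightarrow> represents (\<lambda>x. \<Sum>i<m. c i * (Y (p (Suc i)) x - Y (p i) x))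
    (\<lambda>s. \<Sum>i<m. c i * indicator {p i<..p (Suc i)} s)" for m
  proof (induction m)
    case 0
    show ?case unfolding represents_def by (intro exI[of _ "{}"]) auto
  next
    case (Suc m)
    have pm: "p m \<in> {0..T}" "p (Suc m) \<in> {0..T}" "p m \<le> p (Suc m)"
      using partition_range[OF p] partition_mono[OF p, of m "Suc m"] Suc by auto
    \<comment> \<open>Left-open cells make this an identity at every point, which matters because
      \<open>represents\<close> asks for equal functions and not for equality almost
      everywhere.\<close>
    have ind: "indicator {p m<..p (Suc m)} s = 1 * indicator {0<..p (Suc m)} s + (- 1) * (indicator {0<..p m} s :: real)" for s
      using pm by (auto simp: indicator_def)
    have incr: "Y (p (Suc m)) x - Y (p m) x = 1 * Y (p (Suc m)) x + (- 1) * Y (p m) x" for x by simp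
    have "represents (\<lambda>x. Y (p (Suc m)) x - Y (p m) x) (\<lambda>s. indicator {p m<..p (Suc m)} s)"
      unfolding ind incr by (intro represents_lin represents_value pm)
    from represents_lin[OF Suc.IH this, of 1 "c m"] show ?case
      using Suc by simp
  qed
  then show ?thesis by (simp add: step_int_def[abs_def] step_fun_def[abs_def])
qed

lemma represents_measurable[measurable_dest]: "represents Z f \<Longrightarrow> Z \<in> borel_measurable P"
  using Y_measurable by (auto simp: represents_def intro!: borel_measurable_sum borel_measurable_times)

lemma represents_sq_integrable: "represents Z f \<Longrightarrow> sq_integrable f"
  by (auto simp: represents_def intro!: sq_integrable_sum sq_integrable_indicator)

text \<open>By \<open>Y_cov\<close> and bilinearity the second moment depends on the integrand
  alone. This isometry is what extends the integral beyond step functions.\<close>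

lemma represents_second_moment:
  assumes "represents Z f"
  shows "integrable P (\<lambda>x. (Z x)\<^sup>2)" "(\<integral>x. (Z x)\<^sup>2 \<partial>P) = conv_form k f f"
proof -
  obtain J c where J: "finite J" "J \<subseteq> {0..T}" and Z: "Z = (\<lambda>x. \<Sum>t\<in>J. c t * Y t x)"
    and f: "f = (\<lambda>s. \<Sum>t\<in>J. c t * indicator {0<..t} s)"
    using assms by (auto simp: represents_def)
  have i: "integrable P (\<lambda>x. Y t x * Y s x)" if "t \<in> J" "s \<in> J" for t s
    using that J by (intro integrable_sq_add(2) Y_measurable Y_sq) auto
  have Z2: "(\<lambda>x. (Z x)\<^sup>2) = (\<lambda>x. \<Sum>t\<in>J. \<Sum>s\<in>J. c t * c s * (Y t x * Y s x))"
    unfolding Z by (simp add: power2_eq_square sum_product mult_ac)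
  show "integrable P (\<lambda>x. (Z x)\<^sup>2)"
    unfolding Z2 using i by (intro Bochner_Integration.integrable_sum integrable_mult_right) auto
  have "(\<integral>x. (Z x)\<^sup>2 \<partial>P) = (\<Sum>t\<in>J. \<Sum>s\<in>J. c t * c s * (\<integral>x. Y t x * Y s x \<partial>P))"
    unfolding Z2 using i by (simp add: Bochner_Integration.integral_sum)
  also have "\<dots> = (\<Sum>t\<in>J. c t * (\<Sum>s\<in>J. c s * conv_form k (indicator {0<..t}) (indicator {0<..s})))"
    using J by (auto simp: Y_cov subset_iff sum_distrib_left mult.assoc intro!: sum.cong)
  also have "\<dots> = (\<Sum>t\<in>J. c t * conv_form k (indicator {0<..t}) f)"
    unfolding f by (subst conv_form_sum_right[OF J(1) sq_integrable_indicator sq_integrable_indicator]) (rule refl)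
  also have "\<dots> = conv_form k f f"
    unfolding conv_form_sum_left[OF J(1) sq_integrable_indicator represents_sq_integrable[OF assms], symmetric]
    by (rule arg_cong2[where f = "conv_form k", OF f[symmetric] refl])
  finally show "(\<integral>x. (Z x)\<^sup>2 \<partial>P) = conv_form k f f" .
qed

lemma represents_char:
  assumes Z: "represents Z f"
  shows "(CLINT x|P. iexp (Z x)) = exp (- conv_form k f f / 2)"
  using Z Y_char represents_second_moment(2)[OF Z] by (auto simp: represents_def)

lemma represents_dist:
  assumes "represents Z f" "represents Z' f'"
  shows "(\<integral>\<^sup>+x. ennreal ((Z x - Z' x)\<^sup>2) \<partial>P) \<le> ennreal (\<kappa> * sq_norm (\<lambda>s. f s - f' s))"
proof -
  have r: "represents (\<lambda>x. Z x - Z' x) (\<lambda>s. f s - f' s)"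
    using represents_lin[OF assms, of 1 "- 1"] by simp
  have "(\<integral>\<^sup>+x. ennreal ((Z x - Z' x)\<^sup>2) \<partial>P) = ennreal (conv_form k (\<lambda>s. f s - f' s) (\<lambda>s. f s - f' s))"
    using represents_second_moment[OF r] by (subst nn_integral_eq_integral) auto
  also have "\<dots> \<le> ennreal (\<kappa> * sq_norm (\<lambda>s. f s - f' s))"
    using conv_form_diag_bound[OF represents_sq_integrable[OF r]] by (intro ennreal_leI) auto
  finally show ?thesis .
qed

end

text \<open>The integrand \<open>h0\<close> matters on \<open>{0..T}\<close> only and may be
  arbitrary elsewhere, even non-measurable; \<open>h\<close> is its extension by zero, to which the
  theory on the whole line applies.\<close>

locale integrated_kernel_integrand = integrated_kernel_process +
  fixes h0 h :: "real \<Rightarrow> real"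
  assumes h_def: "h = (\<lambda>s. indicator {0..T} s * h0 s)" and h_sq: "sq_integrable h"
begin

lemma step_L2_dist:
  assumes p: "is_partition T n p"
  shows "(\<integral>\<^sup>+ s\<in>{0..T}. ennreal ((step_fun n p c s - h0 s)\<^sup>2) \<partial>lborel) = ennreal (sq_norm (\<lambda>s. step_fun n p c s - h s))"
proof -
  have "(\<integral>\<^sup>+ s\<in>{0..T}. ennreal ((step_fun n p c s - h0 s)\<^sup>2) \<partial>lborel) = (\<integral>\<^sup>+ s. ennreal ((step_fun n p c s - h s)\<^sup>2) \<partial>lborel)"
  proof (intro nn_integral_cong)
    fix s
    show "ennreal ((step_fun n p c s - h0 s)\<^sup>2) * indicator {0..T} s = ennreal ((step_fun n p c s - h s)\<^sup>2)"
      using step_fun_outside[OF p, of s c] by (cases "s \<in> {0..T}") (auto simp: h_def)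
  qed
  also have "\<dots> = ennreal (sq_norm (\<lambda>s. step_fun n p c s - h s))"
    unfolding sq_norm_def using sq_integrable_diff[OF sq_integrable_step_fun h_sq]
    by (intro nn_integral_eq_integral) (auto simp: sq_integrable_def)
  finally show ?thesis .
qed

lemma approximating_steps:
  assumes "\<And>j::nat. r j > 0"
  obtains n p c where "\<And>j. is_partition T (n j) (p j)"
    "\<And>j. sq_norm (\<lambda>s. step_fun (n j) (p j) (c j) s - h s) < r j"
proof -
  have "\<exists>n p c. is_partition T n p \<and> sq_norm (\<lambda>s. step_fun n p c s - h s) < r j" for j
    by (intro step_fun_dense h_sq T_pos assms) (simp add: h_def)
  then show ?thesis using that by metis
qed

lemma step_int_dist:
  assumes "is_partition T n p" "is_partition T n' p'"
  shows "(\<integral>\<^sup>+x. ennreal ((step_int Y n p c x - step_int Y n' p' c' x)\<^sup>2) \<partial>P) \<le>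
    ennreal (2 * \<kappa> * (sq_norm (\<lambda>s. step_fun n p c s - h s) + sq_norm (\<lambda>s. step_fun n' p' c' s - h s)))"
proof -
  have "\<kappa> * sq_norm (\<lambda>s. step_fun n p c s - step_fun n' p' c' s) \<le>
    \<kappa> * (2 * sq_norm (\<lambda>s. step_fun n p c s - h s) + 2 * sq_norm (\<lambda>s. h s - step_fun n' p' c' s))"
    by (intro mult_left_mono sq_norm_triangle \<kappa>_nonneg sq_integrable_step_fun h_sq)
  then have "ennreal (\<kappa> * sq_norm (\<lambda>s. step_fun n p c s - step_fun n' p' c' s)) \<le>
    ennreal (2 * \<kappa> * (sq_norm (\<lambda>s. step_fun n p c s - h s) + sq_norm (\<lambda>s. step_fun n' p' c' s - h s)))"
    by (intro ennreal_leI) (simp add: algebra_simps sq_norm_diff_commute[of h])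
  then show ?thesis
    using represents_dist[OF represents_step[OF assms(1)] represents_step[OF assms(2)]] by (rule order_trans[rotated])
qed

text \<open>This is completeness of the space of square-integrable variables, carried out for one
  rapidly converging sequence: an almost sure limit is constructed and Fatou's lemma bounds its
  mean-square error. The definition quantifies over all approximating sequences, so any other one is
  then compared with the fixed one.\<close>

lemma ms_integral_exists: "\<exists>I. ms_integral P Y T h0 I"
proof -
  obtain n p c where p: "\<And>j. is_partition T (n j) (p j)"
    and a: "\<And>j. sq_norm (\<lambda>s. step_fun (n j) (p j) (c j) s - h s) < (1 / 4) ^ j"
    using approximating_steps[of "\<lambda>j. (1 / 4) ^ j"] by auto
  define S where "S j = step_int Y (n j) (p j) (c j)" for j
  have Sm[measurable]: "S j \<in> borel_measurable P" for j
    unfolding S_def using represents_step[OF p] by (rule represents_measurable)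
  have SS: "(\<integral>\<^sup>+x. ennreal ((S i x - S j x)\<^sup>2) \<partial>P) \<le> ennreal (4 * \<kappa> * (1 / 4) ^ i)" if "i \<le> j" for i j
  proof -
    have "(1 / 4 :: real) ^ j \<le> (1 / 4) ^ i" using that by (intro power_decreasing) auto
    then have "sq_norm (\<lambda>s. step_fun (n i) (p i) (c i) s - h s) + sq_norm (\<lambda>s. step_fun (n j) (p j) (c j) s - h s)
      \<le> 2 * (1 / 4) ^ i"
      using a[of i] a[of j] by linarith
    then have "2 * \<kappa> * (sq_norm (\<lambda>s. step_fun (n i) (p i) (c i) s - h s) + sq_norm (\<lambda>s. step_fun (n j) (p j) (c j) s - h s))
      \<le> 2 * \<kappa> * (2 * (1 / 4) ^ i)"
      using \<kappa>_nonneg by (intro mult_left_mono) auto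
    then show ?thesis
      unfolding S_def by (intro order_trans[OF step_int_dist[OF p p]] ennreal_leI) simp
  qed
  \<comment> \<open>This approximating sequence is fast enough for its increments to be summable almost surely.\<close>
  have D: "(\<integral>\<^sup>+x. ennreal \<bar>S (Suc j) x - S j x\<bar> \<partial>P) \<le> ennreal ((1 + 4 * \<kappa>) * (1 / 2) ^ j)" for j
  proof -
    \<comment> \<open>The weight \<open>2 ^ j\<close> is chosen because the squared increments have
      mean of order \<open>(1 / 4) ^ j\<close>: both terms then have order
      \<open>(1 / 2) ^ j\<close>.\<close>
    have pt: "\<bar>d\<bar> \<le> (1 / 2) ^ j + 2 ^ j * d\<^sup>2" for d :: real
    proof -
      have "2 * 1 * (2 ^ j * \<bar>d\<bar>) \<le> 1\<^sup>2 + (2 ^ j * \<bar>d\<bar>)\<^sup>2" by (rule sum_squares_bound)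
      moreover have "0 \<le> 2 ^ j * \<bar>d\<bar>" by simp
      ultimately have "2 ^ j * \<bar>d\<bar> \<le> 1 + (2 ^ j * \<bar>d\<bar>)\<^sup>2" unfolding one_power2 by linarith
      also have "\<dots> = 2 ^ j * ((1 / 2) ^ j + 2 ^ j * d\<^sup>2)"
        by (simp add: power_mult_distrib power2_eq_square distrib_left power_one_over)
      finally show ?thesis by simp
    qed
    have "(\<integral>\<^sup>+x. ennreal \<bar>S (Suc j) x - S j x\<bar> \<partial>P) \<le> (\<integral>\<^sup>+x. ennreal ((1 / 2) ^ j) + ennreal (2 ^ j) * ennreal ((S j x - S (Suc j) x)\<^sup>2) \<partial>P)"
      using pt by (intro nn_integral_mono)
        (auto simp: ennreal_plus[symmetric] ennreal_mult[symmetric] power2_commute[of "S j _"] simp del: ennreal_plus intro!: ennreal_leI)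
    also have "\<dots> = ennreal ((1 / 2) ^ j) + ennreal (2 ^ j) * (\<integral>\<^sup>+x. ennreal ((S j x - S (Suc j) x)\<^sup>2) \<partial>P)"
      by (subst nn_integral_add) (auto simp: nn_integral_cmult emeasure_space_1)
    also have "\<dots> \<le> ennreal ((1 / 2) ^ j) + ennreal (2 ^ j) * ennreal (4 * \<kappa> * (1 / 4) ^ j)"
      by (intro add_left_mono mult_left_mono SS) auto
    also have "\<dots> = ennreal ((1 / 2) ^ j + 2 ^ j * (4 * \<kappa> * (1 / 4) ^ j))"
      using \<kappa>_nonneg by (simp add: ennreal_mult ennreal_plus)
    also have "(1 / 2) ^ j + 2 ^ j * (4 * \<kappa> * (1 / 4) ^ j) = (1 + 4 * \<kappa>) * (1 / 2) ^ j"
    proof -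
      have "(2::real) ^ j * (1 / 4) ^ j = (1 / 2) ^ j" by (simp add: power_mult_distrib[symmetric])
      then show ?thesis by (simp add: algebra_simps)
    qed
    finally show ?thesis .
  qed
  have sm: "summable (\<lambda>j. (1 + 4 * \<kappa>) * (1 / 2) ^ j)"
    by (intro summable_mult summable_geometric) simp
  have "(\<integral>\<^sup>+x. (\<Sum>j. ennreal \<bar>S (Suc j) x - S j x\<bar>) \<partial>P) = (\<Sum>j. \<integral>\<^sup>+x. ennreal \<bar>S (Suc j) x - S j x\<bar> \<partial>P)"
    by (rule nn_integral_suminf) measurable
  also have "\<dots> \<le> (\<Sum>j. ennreal ((1 + 4 * \<kappa>) * (1 / 2) ^ j))"
    by (intro suminf_le D) auto
  also have "\<dots> = ennreal (\<Sum>j. (1 + 4 * \<kappa>) * (1 / 2) ^ j)"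
    by (rule suminf_ennreal2[OF _ sm]) (simp add: \<kappa>_nonneg)
  also have "\<dots> < \<infinity>" by (rule ennreal_less_top[unfolded infinity_ennreal_def[symmetric]])
  finally have "AE x in P. (\<Sum>j. ennreal \<bar>S (Suc j) x - S j x\<bar>) \<noteq> \<infinity>"
    by (intro nn_integral_PInf_AE) auto
  then have AElim: "AE x in P. (\<lambda>j. S j x) \<longlonglongrightarrow> lim (\<lambda>j. S j x)"
  proof eventually_elim
    case (elim x)
    then have "summable (\<lambda>j. \<bar>S (Suc j) x - S j x\<bar>)"
      by (intro summable_suminf_not_top) auto
    then have "summable (\<lambda>j. S (Suc j) x - S j x)" by (rule summable_rabs_cancel)
    then have "convergent (\<lambda>m. \<Sum>j<m. S (Suc j) x - S j x)" by (simp add: summable_iff_convergent)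
    then have "convergent (\<lambda>m. (\<Sum>j<m. S (Suc j) x - S j x) + S 0 x)"
      by (intro convergent_add convergent_const)
    moreover have "(\<Sum>j<m. S (Suc j) x - S j x) + S 0 x = S m x" for m
      using sum_lessThan_telescope[of "\<lambda>j. S j x" m] by simp
    ultimately show ?case by (simp add: convergent_LIMSEQ_iff)
  qed
  \<comment> \<open>Off the convergence set the value of \<open>lim\<close> is irrelevant, since
    that set has full measure; measurability holds in any case.\<close>
  define I where "I x = lim (\<lambda>j. S j x)" for x
  have [measurable]: "I \<in> borel_measurable P"
    unfolding I_def by (rule borel_measurable_lim_metric) measurable
  have SI: "(\<integral>\<^sup>+x. ennreal ((S i x - I x)\<^sup>2) \<partial>P) \<le> ennreal (4 * \<kappa> * (1 / 4) ^ i)" for i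
  proof -
    have "(\<integral>\<^sup>+x. ennreal ((S i x - I x)\<^sup>2) \<partial>P) = (\<integral>\<^sup>+x. liminf (\<lambda>j. ennreal ((S i x - S j x)\<^sup>2)) \<partial>P)"
    proof (rule nn_integral_cong_AE)
      show "AE x in P. ennreal ((S i x - I x)\<^sup>2) = liminf (\<lambda>j. ennreal ((S i x - S j x)\<^sup>2))"
        using AElim
      proof eventually_elim
        case (elim x)
        have "(\<lambda>j. ennreal ((S i x - S j x)\<^sup>2)) \<longlonglongrightarrow> ennreal ((S i x - I x)\<^sup>2)"
          using elim unfolding I_def by (intro tendsto_intros)
        then show ?case by (intro lim_imp_Liminf[symmetric]) auto
      qed
    qed
    also have "\<dots> \<le> liminf (\<lambda>j. \<integral>\<^sup>+x. ennreal ((S i x - S j x)\<^sup>2) \<partial>P)"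
      by (intro nn_integral_liminf) measurable
    also have "\<dots> \<le> liminf (\<lambda>j. ennreal (4 * \<kappa> * (1 / 4) ^ i))"
      by (intro Liminf_mono eventually_sequentiallyI[of i] SS)
    finally show ?thesis by (simp add: Liminf_const)
  qed
  have "ms_integral P Y T h0 I"
    unfolding ms_integral_def
  proof (intro conjI allI impI)
    fix n' p' c'
    assume "(\<forall>k. is_partition T (n' k) (p' k)) \<and>
      ((\<lambda>k. \<integral>\<^sup>+ s\<in>{0..T}. ennreal ((step_fun (n' k) (p' k) (c' k) s - h0 s)\<^sup>2) \<partial>lborel) \<longlonglongrightarrow> 0)"
    then have p': "\<And>k. is_partition T (n' k) (p' k)"
      and lim: "(\<lambda>k. ennreal (sq_norm (\<lambda>s. step_fun (n' k) (p' k) (c' k) s - h s))) \<longlonglongrightarrow> ennreal 0"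
      using step_L2_dist by auto
    let ?r = "\<lambda>k. sq_norm (\<lambda>s. step_fun (n' k) (p' k) (c' k) s - h s)"
    \<comment> \<open>At index \<open>k\<close> the given step integral is compared with
      \<open>S k\<close>, and \<open>S k\<close> with \<open>I\<close>. The outer factors 2 come
      from this detour, the inner one in the first term from passing through
      \<open>h\<close>.\<close>
    let ?b = "\<lambda>k. 2 * (2 * \<kappa> * (?r k + (1 / 4) ^ k)) + 2 * (4 * \<kappa> * (1 / 4) ^ k)"
    have r0: "?r \<longlonglongrightarrow> 0"
      using lim by (subst (asm) tendsto_ennreal_iff) (auto simp: sq_norm_nonneg)
    have q0: "(\<lambda>k. (1 / 4 :: real) ^ k) \<longlonglongrightarrow> 0" by (intro LIMSEQ_realpow_zero) auto
    have "?b \<longlonglongrightarrow> 2 * (2 * \<kappa> * (0 + 0)) + 2 * (4 * \<kappa> * 0)"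
      by (intro tendsto_intros r0 q0)
    then have b0: "(\<lambda>k. ennreal (?b k)) \<longlonglongrightarrow> 0"
      by (intro tendsto_ennreal_iff[THEN iffD2, of _ _ 0, simplified]) (auto simp: \<kappa>_nonneg sq_norm_nonneg)
    show "(\<lambda>k. \<integral>\<^sup>+ x. ennreal ((step_int Y (n' k) (p' k) (c' k) x - I x)\<^sup>2) \<partial>P) \<longlonglongrightarrow> 0"
    proof (rule tendsto_sandwich[OF _ _ tendsto_const b0])
      show "\<forall>\<^sub>F k in sequentially. (\<integral>\<^sup>+ x. ennreal ((step_int Y (n' k) (p' k) (c' k) x - I x)\<^sup>2) \<partial>P) \<le> ennreal (?b k)"
      proof (intro always_eventually allI)
        fix k
        let ?Z = "step_int Y (n' k) (p' k) (c' k)"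
        have [measurable]: "?Z \<in> borel_measurable P"
          using represents_step[OF p'] by (rule represents_measurable)
        have pt: "(x - z)\<^sup>2 \<le> 2 * (x - y)\<^sup>2 + 2 * (y - z)\<^sup>2" for x y z :: real
          using zero_le_power2[of "x - 2 * y + z"] by (simp add: power2_eq_square algebra_simps)
        have "(\<integral>\<^sup>+ x. ennreal ((?Z x - I x)\<^sup>2) \<partial>P) \<le> (\<integral>\<^sup>+ x. 2 * ennreal ((?Z x - S k x)\<^sup>2) + 2 * ennreal ((S k x - I x)\<^sup>2) \<partial>P)"
        proof (intro nn_integral_mono)
          fix x
          have "2 * ennreal ((?Z x - S k x)\<^sup>2) + 2 * ennreal ((S k x - I x)\<^sup>2) = ennreal (2 * (?Z x - S k x)\<^sup>2 + 2 * (S k x - I x)\<^sup>2)"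
            by (simp add: ennreal_mult)
          then show "ennreal ((?Z x - I x)\<^sup>2) \<le> 2 * ennreal ((?Z x - S k x)\<^sup>2) + 2 * ennreal ((S k x - I x)\<^sup>2)"
            using pt by (simp add: ennreal_leI del: ennreal_plus)
        qed
        also have "\<dots> = 2 * (\<integral>\<^sup>+ x. ennreal ((?Z x - S k x)\<^sup>2) \<partial>P) + 2 * (\<integral>\<^sup>+ x. ennreal ((S k x - I x)\<^sup>2) \<partial>P)"
          by (subst nn_integral_add) (auto simp: nn_integral_cmult)
        also have "\<dots> \<le> 2 * ennreal (2 * \<kappa> * (?r k + (1 / 4) ^ k)) + 2 * ennreal (4 * \<kappa> * (1 / 4) ^ k)"
        proof (intro add_mono mult_left_mono SI)
          have "2 * \<kappa> * (?r k + sq_norm (\<lambda>s. step_fun (n k) (p k) (c k) s - h s)) \<le> 2 * \<kappa> * (?r k + (1 / 4) ^ k)"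
            using a[of k] \<kappa>_nonneg by (intro mult_left_mono add_left_mono) auto
          then show "(\<integral>\<^sup>+ x. ennreal ((?Z x - S k x)\<^sup>2) \<partial>P) \<le> ennreal (2 * \<kappa> * (?r k + (1 / 4) ^ k))"
            unfolding S_def by (intro order_trans[OF step_int_dist[OF p' p]] ennreal_leI)
        qed auto
        also have "\<dots> = ennreal (?b k)"
        proof -
          have "2 * ennreal u + 2 * ennreal v = ennreal (2 * u + 2 * v)" if "0 \<le> u" "0 \<le> v" for u v
            using that by (simp add: ennreal_mult)
          then show ?thesis using \<kappa>_nonneg by (simp add: sq_norm_nonneg del: ennreal_plus)
        qed
        finally show "(\<integral>\<^sup>+ x. ennreal ((?Z x - I x)\<^sup>2) \<partial>P) \<le> ennreal (?b k)" .
      qed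
    qed auto
  qed measurable
  then show ?thesis by blast
qed

text \<open>Joint Gaussianity of \<open>Z\<close> and \<open>I\<close>: for step integrals
  \<open>S j\<close> the exponent is the quadratic form at \<open>f + s * g j\<close>, and both
  sides pass to the limit.\<close>

lemma ms_integral_char:
  assumes I: "ms_integral P Y T h0 I" and Z: "represents Z f"
  shows "(CLINT x|P. iexp (Z x + s * I x)) = exp (- (conv_form k f f + 2 * s * conv_form k f h + s\<^sup>2 * conv_form k h h) / 2)"
proof -
  obtain n p c where p: "\<And>j. is_partition T (n j) (p j)"
    and a: "\<And>j. sq_norm (\<lambda>s. step_fun (n j) (p j) (c j) s - h s) < (1 / 4) ^ j"
    using approximating_steps[of "\<lambda>j. (1 / 4) ^ j"] by auto
  note Zm[measurable] = represents_measurable[OF Z] and fsq = represents_sq_integrable[OF Z]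
  have Im[measurable]: "I \<in> borel_measurable P" using I by (simp add: ms_integral_def)
  define S where "S j = step_int Y (n j) (p j) (c j)" for j
  define g where "g j = step_fun (n j) (p j) (c j)" for j
  have rS: "represents (S j) (g j)" for j unfolding S_def g_def by (rule represents_step[OF p])
  have q0: "(\<lambda>j. (1 / 4 :: real) ^ j) \<longlonglongrightarrow> 0" by (intro LIMSEQ_realpow_zero) auto
  have g0: "(\<lambda>j. sq_norm (\<lambda>x. g j x - h x)) \<longlonglongrightarrow> 0"
    by (rule tendsto_sandwich[OF _ _ tendsto_const q0])
      (auto intro!: always_eventually simp: sq_norm_nonneg g_def less_imp_le[OF a])
  then have "(\<lambda>j. ennreal (sq_norm (\<lambda>x. g j x - h x))) \<longlonglongrightarrow> ennreal 0"
    by (intro tendsto_ennrealI)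
  then have S0: "(\<lambda>j. \<integral>\<^sup>+x. ennreal ((S j x - I x)\<^sup>2) \<partial>P) \<longlonglongrightarrow> 0"
    using I p unfolding ms_integral_def S_def g_def step_L2_dist[OF p, symmetric] by simp
  have Sm: "S j \<in> borel_measurable P" for j using rS by (rule represents_measurable)
  have "(\<lambda>j. CLINT x|P. iexp (Z x + s * S j x)) \<longlonglongrightarrow> (CLINT x|P. iexp (Z x + s * I x))"
    by (rule iexp_tendsto_of_L2[OF Zm Im Sm S0])
  moreover have "(\<lambda>j. CLINT x|P. iexp (Z x + s * S j x)) \<longlonglongrightarrow>
     exp (- conv_form k (\<lambda>x. f x + s * h x) (\<lambda>x. f x + s * h x) / 2)"
  proof -
    have r: "represents (\<lambda>x. Z x + s * S j x) (\<lambda>x. f x + s * g j x)" for j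
      using represents_lin[OF Z rS, of 1 s] by simp
    have "sq_norm (\<lambda>x. (f x + s * g j x) - (f x + s * h x)) = s\<^sup>2 * sq_norm (\<lambda>x. g j x - h x)" for j
      unfolding sq_norm_def by (simp add: power_mult_distrib flip: right_diff_distrib)
    then have "(\<lambda>j. sq_norm (\<lambda>x. (f x + s * g j x) - (f x + s * h x))) \<longlonglongrightarrow> 0"
      using tendsto_mult_right_zero[OF g0, of "s\<^sup>2"] by simp
    then have "(\<lambda>j. conv_form k (\<lambda>x. f x + s * g j x) (\<lambda>x. f x + s * g j x)) \<longlonglongrightarrow> conv_form k (\<lambda>x. f x + s * h x) (\<lambda>x. f x + s * h x)"
      by (intro conv_form_tendsto sq_integrable_add_mult fsq h_sq represents_sq_integrable[OF rS])
    then show ?thesis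
      unfolding represents_char[OF r] by (intro tendsto_intros) auto
  qed
  ultimately have "(CLINT x|P. iexp (Z x + s * I x)) = exp (- conv_form k (\<lambda>x. f x + s * h x) (\<lambda>x. f x + s * h x) / 2)"
    by (rule LIMSEQ_unique)
  then show ?thesis unfolding conv_form_quadratic[OF fsq h_sq] .
qed

end

subsection \<open>Change of measure\<close>

locale integral_equation_solution = integrated_kernel_integrand +
  assumes solution: "AE t in lborel. t \<in> {0..T} \<longrightarrow> (\<integral>u. h u * k (t - u) \<partial>lborel) = 1"
begin

text \<open>The integral equation acts through this identity: after Fubini the inner integral is the
  convolution of \<open>h\<close> with \<open>k\<close>, equal to 1 almost everywhere on
  \<open>{0..T}\<close>. The support condition on \<open>g\<close> is there because nothing is known
  about that convolution outside the interval.\<close>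

lemma conv_form_solution:
  assumes g: "sq_integrable g" and g0: "\<And>s. s \<notin> {0..T} \<Longrightarrow> g s = 0"
  shows "conv_form k g h = (\<integral>x. g x \<partial>lborel)"
proof -
  note [measurable] = sq_integrable_measurable[OF g] sq_integrable_measurable[OF h_sq]
  have "conv_form k g h = (\<integral>u. (\<integral>v. g u * h v * k (u - v) \<partial>lborel) \<partial>lborel)"
    unfolding conv_form_def using lborel_pair.integral_fst'[OF conv_form_bound(1)[OF g h_sq]] by simp
  also have "\<dots> = (\<integral>u. g u * (\<integral>v. h v * k (u - v) \<partial>lborel) \<partial>lborel)"
    by (simp add: mult.assoc)
  also have "\<dots> = (\<integral>x. g x \<partial>lborel)"
  proof (rule integral_cong_AE)
    show "AE u in lborel. g u * (\<integral>v. h v * k (u - v) \<partial>lborel) = g u"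
      using solution by eventually_elim (use g0 in force)
  qed measurable
  finally show ?thesis .
qed

definition H :: real where "H = (\<integral>s. h s \<partial>lborel)"

lemma conv_form_solution_diag: "conv_form k h h = H"
  unfolding H_def by (intro conv_form_solution h_sq) (simp add: h_def)

lemma conv_form_step_solution:
  assumes J: "finite J" "J \<subseteq> {0..T}"
  shows "conv_form k (\<lambda>s. \<Sum>t\<in>J. c t * indicator {0<..t} s) h = (\<Sum>t\<in>J. c t * t)"
proof -
  have "conv_form k (indicator {0<..t}) h = t" if "t \<in> J" for t
  proof -
    have "conv_form k (indicator {0<..t}) h = (\<integral>x. indicator {0<..t} x \<partial>lborel)"
      using that J by (intro conv_form_solution sq_integrable_indicator) (auto simp: indicator_def)
    then show ?thesis using that J by auto
  qed
  then show ?thesis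
    by (simp add: conv_form_sum_left[OF J(1) sq_integrable_indicator h_sq])
qed

text \<open>Since a characteristic function has modulus at most 1, the exponent of that of \<open>Y T + s I\<close> is nonnegative
  for all \<open>s\<close>; its coefficient of \<open>s\<close> is \<open>2 T > 0\<close>, so that of \<open>s\<^sup>2\<close> cannot be nonpositive.\<close>

lemma H_pos:
  assumes I: "ms_integral P Y T h0 I"
  shows "H > 0"
proof (rule ccontr)
  assume "\<not> H > 0"
  have Tr: "T \<in> {0..T}" using T_pos by simp
  let ?f = "indicator {0<..T} :: real \<Rightarrow> real"
  have \<rho>: "conv_form k ?f h = T"
    using conv_form_step_solution[of "{T}" "\<lambda>_. 1"] T_pos by simp
  have nn: "0 \<le> conv_form k ?f ?f + 2 * s * T + s\<^sup>2 * H" for s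
  proof -
    have [measurable]: "Y T \<in> borel_measurable P" "I \<in> borel_measurable P"
      using Y_measurable[OF Tr] I by (auto simp: ms_integral_def)
    have "norm (CLINT x|P. iexp (Y T x + s * I x)) \<le> (\<integral>x. norm (iexp (Y T x + s * I x)) \<partial>P)"
      by (rule integral_norm_bound)
    also have "\<dots> = 1" by (simp add: prob_space del: of_real_add of_real_mult)
    finally show ?thesis
      unfolding ms_integral_char[OF I represents_value[OF Tr]] \<rho> conv_form_solution_diag
      by simp
  qed
  define s where "s = - (conv_form k ?f ?f + 1) / (2 * T)"
  have "conv_form k ?f ?f + 2 * s * T = - 1" using T_pos by (simp add: s_def field_simps)
  moreover have "s\<^sup>2 * H \<le> 0" using \<open>\<not> H > 0\<close> by (intro mult_nonneg_nonpos) auto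
  ultimately show False using nn[of s] by linarith
qed

text \<open>With \<open>q\<close>, \<open>\<rho>\<close> and \<open>H\<close> the variance of
  \<open>Z\<close>, its covariance with \<open>I\<close> and the variance of \<open>I\<close>, the
  mean of \<open>exp (\<theta> * I x)\<close> times \<open>iexp (Z x)\<close> has logarithm
  \<open>(\<theta>\<^sup>2 * H + 2 * \<i> * \<theta> * \<rho> - q) / 2\<close>. The normalising
  factor removes the first term; the second is the phase of a shift by
  \<open>\<theta> * \<rho>\<close>.\<close>

lemma change_of_measure_char:
  assumes I: "ms_integral P Y T h0 I" and J: "finite J" "J \<subseteq> {0..T}"
  shows "integrable P (\<lambda>x. exp (\<theta> * I x - \<theta>\<^sup>2 / 2 * H))"
    and "(CLINT x|P. exp (\<theta> * I x - \<theta>\<^sup>2 / 2 * H) *\<^sub>R iexp (\<Sum>t\<in>J. c t * Y t x)) =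
      (CLINT x|P. iexp (\<Sum>t\<in>J. c t * (\<theta> * t + Y t x)))"
proof -
  note H = H_pos[OF I]
  have Im[measurable]: "I \<in> borel_measurable P" using I by (simp add: ms_integral_def)
  define Z where "Z = (\<lambda>x. \<Sum>t\<in>J. c t * Y t x)"
  define f where "f = (\<lambda>s. \<Sum>t\<in>J. c t * indicator {0<..t} s :: real)"
  have Z: "represents Z f" unfolding represents_def Z_def f_def using J by blast
  note Zm[measurable] = represents_measurable[OF Z]
  define \<rho> where "\<rho> = (\<Sum>t\<in>J. c t * t)"
  have \<rho>: "conv_form k f h = \<rho>" unfolding f_def \<rho>_def by (rule conv_form_step_solution[OF J])
  define q where "q = conv_form k f f"
  \<comment> \<open>The regression coefficient making \<open>Z - a I\<close> uncorrelated with \<open>I\<close>.\<close>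
  define a where "a = \<rho> / H"
  define V where "V x = Z x - a * I x" for x
  have [measurable]: "V \<in> borel_measurable P" unfolding V_def by measurable
  have sH: "(sqrt H)\<^sup>2 = H" using H by simp
  have rep0: "represents (\<lambda>x. 0) (\<lambda>x. 0)"
    unfolding represents_def by (intro exI[of _ "{}"]) auto
  have eI: "(CLINT x|P. iexp (s * I x)) = exp (- (s * sqrt H)\<^sup>2 / 2)" for s
    using ms_integral_char[OF I rep0, of s] by (simp add: conv_form_zero conv_form_solution_diag power_mult_distrib sH)
  have eV: "(CLINT x|P. iexp (V x + s * I x)) = exp (- (q - \<rho>\<^sup>2 / H) / 2) * exp (- (s * sqrt H)\<^sup>2 / 2)" for s
  proof -
    have "(CLINT x|P. iexp (V x + s * I x)) = (CLINT x|P. iexp (Z x + (s - a) * I x))"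
      by (simp add: V_def algebra_simps)
    also have "\<dots> = exp (- (q + 2 * (s - a) * \<rho> + (s - a)\<^sup>2 * H) / 2)"
      unfolding ms_integral_char[OF I Z] \<rho> conv_form_solution_diag q_def ..
    \<comment> \<open>The choice of \<open>a\<close> cancels the term linear in \<open>s\<close>;
      the remaining constant \<open>q - \<rho>\<^sup>2 / H\<close> is the variance of
      \<open>V\<close>.\<close>
    also have "q + 2 * (s - a) * \<rho> + (s - a)\<^sup>2 * H = (q - \<rho>\<^sup>2 / H) + (s * sqrt H)\<^sup>2"
      unfolding power_mult_distrib sH a_def using H by (simp add: power2_eq_square field_simps)
    also have "exp (- ((q - \<rho>\<^sup>2 / H) + (s * sqrt H)\<^sup>2) / 2) = exp (- (q - \<rho>\<^sup>2 / H) / 2) * exp (- (s * sqrt H)\<^sup>2 / 2)"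
      by (simp add: exp_add[symmetric] add_divide_distrib diff_divide_distrib)
    finally show ?thesis .
  qed
  have c0: "0 \<le> exp (- (q - \<rho>\<^sup>2 / H) / 2)" by simp
  note W1 = gaussian_exp_weighted(1)[OF prob_space_axioms \<open>V \<in> borel_measurable P\<close> Im c0 eI eV, where \<theta> = \<theta>]
  note W2 = gaussian_exp_weighted(2)[OF prob_space_axioms \<open>V \<in> borel_measurable P\<close> Im c0 eI eV, where \<theta> = \<theta> and a = a]
  have "integrable P (\<lambda>x. exp (\<theta> * I x) * exp (- (\<theta>\<^sup>2 / 2 * H)))"
    using W1 by (intro integrable_mult_left) auto
  then show "integrable P (\<lambda>x. exp (\<theta> * I x - \<theta>\<^sup>2 / 2 * H))"
    by (simp add: exp_add[symmetric])
  have VZ: "V x + a * I x = Z x" for x by (simp add: V_def)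
  have "(CLINT x|P. exp (\<theta> * I x - \<theta>\<^sup>2 / 2 * H) *\<^sub>R iexp (Z x)) =
    (CLINT x|P. exp (- (\<theta>\<^sup>2 / 2 * H)) * (iexp (Z x) * exp (\<theta> * I x)))"
    by (intro Bochner_Integration.integral_cong refl)
      (simp add: scaleR_conv_of_real exp_add[symmetric] exp_of_real[symmetric] algebra_simps del: exp_of_real)
  also have "\<dots> = exp (- (\<theta>\<^sup>2 / 2 * H)) * (CLINT x|P. iexp (Z x) * exp (\<theta> * I x))"
    by (rule integral_mult_right_zero)
  also have "(CLINT x|P. iexp (Z x) * exp (\<theta> * I x)) =
     exp (- (q - \<rho>\<^sup>2 / H) / 2) * exp ((complex_of_real \<theta> + \<i> * a)\<^sup>2 * (sqrt H)\<^sup>2 / 2)"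
    using W2 unfolding VZ by simp
  \<comment> \<open>By \<open>a * H = \<rho>\<close>, the square of
    \<open>\<theta> + \<i> * a\<close> times \<open>H\<close> has real part
    \<open>\<theta>\<^sup>2 * H - \<rho>\<^sup>2 / H\<close>. Its two terms cancel against the
    normalisation and against the variance removed from \<open>q\<close>.\<close>
  also have "exp (- (\<theta>\<^sup>2 / 2 * H)) * (exp (- (q - \<rho>\<^sup>2 / H) / 2) * exp ((complex_of_real \<theta> + \<i> * a)\<^sup>2 * (sqrt H)\<^sup>2 / 2))
     = iexp (\<theta> * \<rho>) * exp (- q / 2)"
  proof -
    have 1: "complex_of_real (sqrt H) ^ 2 = complex_of_real H" by (simp add: sH flip: of_real_power)
    have 2: "complex_of_real a * complex_of_real H = complex_of_real \<rho>" using H by (simp add: a_def)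
    have 3: "complex_of_real a * complex_of_real \<rho> = complex_of_real (\<rho>\<^sup>2 / H)" by (simp add: a_def power2_eq_square)
    have "(complex_of_real \<theta> + \<i> * a)\<^sup>2 * H = complex_of_real (\<theta>\<^sup>2 * H) + 2 * \<i> * \<theta> * (complex_of_real a * H) - complex_of_real a * (complex_of_real a * H)"
      by (simp add: power2_eq_square algebra_simps)
    also have "\<dots> = complex_of_real (\<theta>\<^sup>2 * H) + 2 * \<i> * \<theta> * \<rho> - complex_of_real (\<rho>\<^sup>2 / H)"
      unfolding 2 3 ..
    finally have 4: "(complex_of_real \<theta> + \<i> * a)\<^sup>2 * H = complex_of_real (\<theta>\<^sup>2 * H) + 2 * \<i> * \<theta> * \<rho> - complex_of_real (\<rho>\<^sup>2 / H)" .
    show ?thesis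
      unfolding of_real_mult of_real_power 1 4
      unfolding exp_of_real[symmetric] exp_add[symmetric]
      by (rule arg_cong[where f = exp]) (simp add: field_simps)
  qed
  also have "\<dots> = (CLINT x|P. iexp (\<theta> * \<rho>) * iexp (Z x))"
    using represents_char[OF Z] by (simp add: q_def)
  also have "\<dots> = (CLINT x|P. iexp (\<Sum>t\<in>J. c t * (\<theta> * t + Y t x)))"
  proof (intro Bochner_Integration.integral_cong refl)
    fix x
    have "(\<Sum>t\<in>J. c t * (\<theta> * t + Y t x)) = \<theta> * \<rho> + Z x"
      by (simp add: \<rho>_def Z_def distrib_left sum.distrib sum_distrib_left mult_ac)
    then show "iexp (\<theta> * \<rho>) * iexp (Z x) = iexp (\<Sum>t\<in>J. c t * (\<theta> * t + Y t x))"
      by (simp add: exp_add[symmetric] distrib_left del: of_real_sum)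
  qed
  finally show "(CLINT x|P. exp (\<theta> * I x - \<theta>\<^sup>2 / 2 * H) *\<^sub>R iexp (\<Sum>t\<in>J. c t * Y t x)) =
      (CLINT x|P. iexp (\<Sum>t\<in>J. c t * (\<theta> * t + Y t x)))"
    unfolding Z_def .
qed

end

section \<open>From the given process to its law on path space\<close>

lemma centered_gaussian_rv_moments:
  assumes "prob_space M" and W: "centered_gaussian_rv M W"
  shows "integrable M (\<lambda>x. (W x)\<^sup>2)" "(CLINT x|M. iexp (W x)) = exp (- (\<integral>x. (W x)\<^sup>2 \<partial>M) / 2)"
proof -
  interpret prob_space M by fact
  have [measurable]: "W \<in> borel_measurable M" using W by (simp add: centered_gaussian_rv_def)
  have "integrable M (\<lambda>x. (W x)\<^sup>2) \<and> (CLINT x|M. iexp (W x)) = exp (- (\<integral>x. (W x)\<^sup>2 \<partial>M) / 2)"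
  \<comment> \<open>The degenerate case has no density and is treated apart; otherwise division by
    the standard deviation reduces to the standard normal law.\<close>
  proof (cases "AE x in M. W x = 0")
    case True
    have "integrable M (\<lambda>x. (W x)\<^sup>2) \<longleftrightarrow> integrable M (\<lambda>x. 0::real)"
      using True by (intro integrable_cong_AE) auto
    moreover have "(CLINT x|M. iexp (W x)) = (CLINT x|M. 1)"
      using True by (intro integral_cong_AE) auto
    moreover have "(\<integral>x. (W x)\<^sup>2 \<partial>M) = (\<integral>x. 0 \<partial>M)"
      using True by (intro integral_cong_AE) auto
    ultimately show ?thesis by (simp add: prob_space)
  next
    case False
    then obtain \<sigma> where \<sigma>: "\<sigma> > 0" and D: "distributed M lborel W (\<lambda>x. ennreal (normal_density 0 \<sigma> x))"
      using W by (auto simp: centered_gaussian_rv_def)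
    have N: "distributed M lborel (\<lambda>x. W x / \<sigma>) (\<lambda>x. ennreal (std_normal_density x))"
      using D normal_standard_normal_convert[OF \<sigma>, of W 0] by simp
    have m2: "has_bochner_integral lborel (\<lambda>x. std_normal_density x * x\<^sup>2) 1"
      using std_normal_moment_even[of 1] by simp
    have i: "integrable M (\<lambda>x. (W x / \<sigma>)\<^sup>2)"
      using distributed_integrable[OF N, of "\<lambda>x. x\<^sup>2"] m2 by (simp add: has_bochner_integral_iff)
    have e: "(\<integral>x. (W x / \<sigma>)\<^sup>2 \<partial>M) = 1"
      using distributed_integral[OF N, of "\<lambda>x. x\<^sup>2"] m2 by (simp add: has_bochner_integral_iff)
    have W2: "(\<lambda>x. (W x)\<^sup>2) = (\<lambda>x. \<sigma>\<^sup>2 * (W x / \<sigma>)\<^sup>2)"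
      using \<sigma> by (simp add: power_divide)
    have "distr M borel (\<lambda>x. W x / \<sigma>) = std_normal_distribution"
      using distributed_distr_eq_density[OF N] by (simp cong: distr_cong)
    then have "char std_normal_distribution \<sigma> = char (distr M borel (\<lambda>x. W x / \<sigma>)) \<sigma>" by simp
    also have "\<dots> = (CLINT x|M. iexp (\<sigma> * (W x / \<sigma>)))"
      unfolding char_def by (rule integral_distr) measurable
    finally have "char std_normal_distribution \<sigma> = (CLINT x|M. iexp (\<sigma> * (W x / \<sigma>)))" .
    then have "(CLINT x|M. iexp (W x)) = exp (- \<sigma>\<^sup>2 / 2)"
      using \<sigma> by (simp add: char_std_normal_distribution)
    moreover have "integrable M (\<lambda>x. (W x)\<^sup>2)" unfolding W2 using i by (rule integrable_mult_right)
    moreover have "(\<integral>x. (W x)\<^sup>2 \<partial>M) = \<sigma>\<^sup>2"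
      unfolding W2 using e by simp
    ultimately show ?thesis by simp
  qed
  then show "integrable M (\<lambda>x. (W x)\<^sup>2)" "(CLINT x|M. iexp (W x)) = exp (- (\<integral>x. (W x)\<^sup>2 \<partial>M) / 2)" by auto
qed

text \<open>This connects the double integral in Assumption 1 with \<open>conv_form\<close>. Cutting
  the kernel to \<open>{-T..T}\<close> is harmless, as differences of points of
  \<open>{0..T}\<close> stay there, and left endpoints are null sets.\<close>

lemma (in even_kernel) conv_form_indicator:
  assumes st: "0 \<le> s" "s \<le> T" "0 \<le> t" "t \<le> T"
    and K: "\<And>u. k u = indicator {-T..T} u * K u"
  shows "conv_form k (indicator {0<..t}) (indicator {0<..s}) = (LINT u:{0..t}|lborel. (LINT v:{0..s}|lborel. K (u - v)))"
proof -
  have ae: "AE x in lborel. indicator {0<..r} x = (indicator {0..r} x :: real)" for r :: real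
    using AE_lborel_singleton[of 0] by eventually_elim (auto simp: indicator_def)
  have inner: "(\<integral>v. indicator {0<..s} v * k (u - v) \<partial>lborel) = (LINT v:{0..s}|lborel. K (u - v))" if u: "u \<in> {0..t}" for u
  proof -
    have "(\<integral>v. indicator {0<..s} v * k (u - v) \<partial>lborel) = (\<integral>v. indicator {0..s} v * k (u - v) \<partial>lborel)"
      by (rule integral_cong_AE) (measurable, use ae[of s] in eventually_elim, simp)
    also have "\<dots> = (\<integral>v. indicator {0..s} v *\<^sub>R K (u - v) \<partial>lborel)"
      using u st by (intro Bochner_Integration.integral_cong refl) (auto simp: K indicator_def)
    finally show ?thesis by (simp add: set_lebesgue_integral_def)
  qed
  have "conv_form k (indicator {0<..t}) (indicator {0<..s}) =
     (\<integral>u. (\<integral>v. indicator {0<..t} u * indicator {0<..s} v * k (u - v) \<partial>lborel) \<partial>lborel)"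
    unfolding conv_form_def
    using lborel_pair.integral_fst'[OF conv_form_bound(1)[OF sq_integrable_indicator[of 0 t] sq_integrable_indicator[of 0 s]]] by simp
  also have "\<dots> = (\<integral>u. indicator {0<..t} u * (\<integral>v. indicator {0<..s} v * k (u - v) \<partial>lborel) \<partial>lborel)"
    by (simp add: mult.assoc)
  also have "\<dots> = (\<integral>u. indicator {0..t} u * (\<integral>v. indicator {0<..s} v * k (u - v) \<partial>lborel) \<partial>lborel)"
    by (rule integral_cong_AE) (measurable, use ae[of t] in eventually_elim, simp)
  also have "\<dots> = (\<integral>u. indicator {0..t} u *\<^sub>R (LINT v:{0..s}|lborel. K (u - v)) \<partial>lborel)"
  proof (intro Bochner_Integration.integral_cong refl)
    fix u :: real
    show "indicator {0..t} u * (\<integral>v. indicator {0<..s} v * k (u - v) \<partial>lborel) = indicator {0..t} u *\<^sub>R (LINT v:{0..s}|lborel. K (u - v))"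
      by (cases "u \<in> {0..t}") (use inner[of u] in auto)
  qed
  finally show ?thesis by (simp add: set_lebesgue_integral_def)
qed

text \<open>Assumption 1 appears in integrated form: as the process starts at 0, its covariance
  vanishes on the axes and is recovered by integrating the mixed derivative. The density formula is
  claimed for every \<open>I\<close>, because a mean-square integral is determined only up to null
  sets and any version must serve.\<close>

theorem theorem3p3:
  fixes M :: "'a measure" and B :: "real \<Rightarrow> 'a \<Rightarrow> real"
    and K h :: "real \<Rightarrow> real" and \<theta> T :: real
  assumes "prob_space M" and "T > 0"
    and "centered_gaussian_process M B"
    and "stationary_increments M B"
    and "AE \<omega> in M. B 0 \<omega> = 0"
    and "nonsingular_fdd M B T"
    and "\<forall>u. K (- u) = K u"
    and "set_integrable lborel {-T..T} K"
    and "\<forall>s\<in>{0..T}. \<forall>t\<in>{0..T}.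
           (\<integral>\<omega>. B t \<omega> * B s \<omega> \<partial>M) = (LINT u:{0..t}|lborel. (LINT v:{0..s}|lborel. K (u - v)))"
    and "set_borel_measurable lborel {0..T} h"
    and "set_integrable lborel {0..T} (\<lambda>s. (h s)\<^sup>2)"
    and "AE t in lborel. t \<in> {0..T} \<longrightarrow> (LINT s:{0..T}|lborel. K (t - s) * h s) = 1"
  shows "absolutely_continuous (law_X M B 0 T) (law_X M B \<theta> T) \<and>
         (\<exists>I. ms_integral (law_X M B 0 T) (\<lambda>t x. x t) T h I) \<and>
         (\<forall>I. ms_integral (law_X M B 0 T) (\<lambda>t x. x t) T h I \<longrightarrow>
            law_X M B \<theta> T = density (law_X M B 0 T)
              (\<lambda>x. ennreal (exp (\<theta> * I x - \<theta>\<^sup>2 / 2 * (LINT s:{0..T}|lborel. h s)))))"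
proof -
  interpret M: prob_space M by fact
  define k where "k u = indicator {-T..T} u * K u" for u
  define h' where "h' s = indicator {0..T} s * h s" for s
  define P where "P \<theta> = law_X M B \<theta> T" for \<theta>
  have Bm: "B t \<in> borel_measurable M" if "t \<in> {0..T}" for t
    using assms(3) that by (auto simp: centered_gaussian_process_def)
  have Xm: "(\<lambda>\<omega>. \<lambda>t\<in>{0..T}. \<theta> * t + B t \<omega>) \<in> measurable M (path_space T)" for \<theta>
    unfolding path_space_def using Bm by (intro measurable_restrict) auto
  have setsP[measurable_cong]: "sets (P \<theta>) = sets (path_space T)" for \<theta> by (simp add: P_def law_X_def)
  have spP: "space (P \<theta>) = space (path_space T)" for \<theta> by (simp add: P_def law_X_def)
  have coord: "(\<lambda>x. x t) \<in> borel_measurable (path_space T)" if "t \<in> {0..T}" for t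
    unfolding path_space_def using that by (rule measurable_component_singleton)
  have coordP: "(\<lambda>x. x t) \<in> borel_measurable (P \<theta>)" if "t \<in> {0..T}" for t \<theta>
    using coord[OF that] measurable_cong_sets[OF setsP refl] by blast
  have prP: "prob_space (P \<theta>)" for \<theta>
    unfolding P_def law_X_def by (rule M.prob_space_distr[OF Xm])
  have intP: "(\<integral>x. F x \<partial>P \<theta>) = (\<integral>\<omega>. F (\<lambda>t\<in>{0..T}. \<theta> * t + B t \<omega>) \<partial>M)"
    if "F \<in> borel_measurable (path_space T)" for F :: "(real \<Rightarrow> real) \<Rightarrow> 'c::{banach, second_countable_topology}" and \<theta>
    unfolding P_def law_X_def using that by (rule integral_distr[OF Xm])
  have lin_m: "(\<lambda>x. \<Sum>t\<in>J. c t * x t) \<in> borel_measurable (path_space T)" if "J \<subseteq> {0..T}" for J c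
    using that by (intro borel_measurable_sum borel_measurable_times borel_measurable_const coord) auto
  have gauss: "centered_gaussian_rv M (\<lambda>\<omega>. \<Sum>t\<in>J. c t * B t \<omega>)" if "finite J" "J \<subseteq> {0..T}" for J c
    using assms(3) that by (auto simp: centered_gaussian_process_def subset_iff)
  have gaussB: "centered_gaussian_rv M (B t)" if "t \<in> {0..T}" for t
    using gauss[of "{t}" "\<lambda>_. 1"] that by simp
  interpret even_kernel k
  proof
    show "integrable lborel k"
      using assms(8) unfolding set_integrable_def k_def by simp
    show "k (- u) = k u" for u
      using assms(7) by (auto simp: k_def indicator_def)
  qed
  have h'm: "h' \<in> borel_measurable borel"
    using assms(10) unfolding set_borel_measurable_def h'_def by simp
  have charP: "(CLINT x|P \<theta>. iexp (\<Sum>t\<in>J. c t * x t)) = (CLINT \<omega>|M. iexp (\<Sum>t\<in>J. c t * (\<theta> * t + B t \<omega>)))"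
    if J: "finite J" "J \<subseteq> {0..T}" for J c \<theta>
  proof -
    note [measurable] = lin_m[OF J(2)]
    have "(CLINT x|P \<theta>. iexp (\<Sum>t\<in>J. c t * x t)) = (CLINT \<omega>|M. iexp (\<Sum>t\<in>J. c t * (\<lambda>t\<in>{0..T}. \<theta> * t + B t \<omega>) t))"
      by (rule intP) (simp del: of_real_sum)
    also have "\<dots> = (CLINT \<omega>|M. iexp (\<Sum>t\<in>J. c t * (\<theta> * t + B t \<omega>)))"
    proof (intro Bochner_Integration.integral_cong refl)
      fix \<omega>
      have "(\<Sum>t\<in>J. c t * (\<lambda>t\<in>{0..T}. \<theta> * t + B t \<omega>) t) = (\<Sum>t\<in>J. c t * (\<theta> * t + B t \<omega>))"
        using J by (intro sum.cong) auto
      then show "iexp (\<Sum>t\<in>J. c t * (\<lambda>t\<in>{0..T}. \<theta> * t + B t \<omega>) t) = iexp (\<Sum>t\<in>J. c t * (\<theta> * t + B t \<omega>))"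
        by (rule arg_cong)
    qed
    finally show ?thesis .
  qed
  \<comment> \<open>The abstract theory is applied to the coordinate process under the law of
    \<open>B\<close>, which is the case \<theta> = 0.\<close>
  interpret S: integral_equation_solution k "P 0" "\<lambda>t x. x t" T h h'
  proof (intro integral_equation_solution.intro integrated_kernel_integrand.intro integrated_kernel_process.intro
      integrated_kernel_process_axioms.intro integrated_kernel_integrand_axioms.intro integral_equation_solution_axioms.intro
      prP even_kernel_axioms)
    show "T > 0" by fact
    show "(\<lambda>x. x t) \<in> borel_measurable (P 0)" if "t \<in> {0..T}" for t using that by (rule coordP)
    show "integrable (P 0) (\<lambda>x. (x t)\<^sup>2)" if t: "t \<in> {0..T}" for t
    proof -
      note [measurable] = coord[OF t]
      have "integrable M (\<lambda>\<omega>. (B t \<omega>)\<^sup>2)"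
        by (rule centered_gaussian_rv_moments(1)[OF M.prob_space_axioms gaussB[OF t]])
      then show ?thesis
        unfolding P_def law_X_def using t by (subst integrable_distr_eq[OF Xm]) auto
    qed
    show "(\<integral>x. x t * x s \<partial>P 0) = conv_form k (indicator {0<..t}) (indicator {0<..s})"
      if s: "s \<in> {0..T}" and t: "t \<in> {0..T}" for s t
    proof -
      note [measurable] = coord[OF t] coord[OF s]
      have "(\<integral>x. x t * x s \<partial>P 0) = (\<integral>\<omega>. B t \<omega> * B s \<omega> \<partial>M)"
        using s t by (subst intP) auto
      also have "\<dots> = conv_form k (indicator {0<..t}) (indicator {0<..s})"
        using assms(9) s t by (subst conv_form_indicator[where T = T and K = K]) (auto simp: k_def)
      finally show ?thesis .
    qed
    show "(CLINT x|P 0. iexp (\<Sum>t\<in>J. c t * x t)) = exp (- (\<integral>x. (\<Sum>t\<in>J. c t * x t)\<^sup>2 \<partial>P 0) / 2)"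
      if J: "finite J" "J \<subseteq> {0..T}" for J c
    proof -
      note [measurable] = lin_m[OF J(2)]
      have "(\<integral>x. (\<Sum>t\<in>J. c t * x t)\<^sup>2 \<partial>P 0) = (\<integral>\<omega>. (\<Sum>t\<in>J. c t * (\<lambda>t\<in>{0..T}. 0 * t + B t \<omega>) t)\<^sup>2 \<partial>M)"
        by (rule intP) measurable
      also have "\<dots> = (\<integral>\<omega>. (\<Sum>t\<in>J. c t * B t \<omega>)\<^sup>2 \<partial>M)"
        using J by (intro Bochner_Integration.integral_cong refl arg_cong[where f = "\<lambda>x. x\<^sup>2"] sum.cong) auto
      finally show ?thesis
        using centered_gaussian_rv_moments(2)[OF M.prob_space_axioms gauss[OF J], of c] charP[OF J, of 0 c] by simp
    qed
    show "h' = (\<lambda>s. indicator {0..T} s * h s)" by (simp add: h'_def[abs_def])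
    have "(\<lambda>s. (h' s)\<^sup>2) = (\<lambda>s. indicator {0..T} s *\<^sub>R (h s)\<^sup>2)"
      by (auto simp: h'_def indicator_def)
    then show "sq_integrable h'"
      using h'm assms(11) by (simp add: sq_integrable_def set_integrable_def)
    show "AE t in lborel. t \<in> {0..T} \<longrightarrow> (\<integral>u. h' u * k (t - u) \<partial>lborel) = 1"
      using assms(12)
    proof eventually_elim
      case (elim t)
      have "(\<integral>u. h' u * k (t - u) \<partial>lborel) = (LINT s:{0..T}|lborel. K (t - s) * h s)" if "t \<in> {0..T}"
        unfolding set_lebesgue_integral_def using that
        by (intro Bochner_Integration.integral_cong refl) (auto simp: h'_def k_def indicator_def)
      with elim show ?case by simp
    qed
  qed
  have H: "(LINT s:{0..T}|lborel. h s) = S.H"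
    unfolding S.H_def set_lebesgue_integral_def by (simp add: h'_def[abs_def])
  have ex: "\<exists>I. ms_integral (P 0) (\<lambda>t x. x t) T h I" by (rule S.ms_integral_exists)
  have main: "P \<theta> = density (P 0) (\<lambda>x. ennreal (exp (\<theta> * I x - \<theta>\<^sup>2 / 2 * S.H)))"
    if I: "ms_integral (P 0) (\<lambda>t x. x t) T h I" for I
  proof -
    let ?L = "\<lambda>x. exp (\<theta> * I x - \<theta>\<^sup>2 / 2 * S.H)"
    let ?Q = "density (P 0) (\<lambda>x. ennreal (?L x))"
    have [measurable]: "I \<in> borel_measurable (P 0)" using I by (simp add: ms_integral_def)
    interpret P\<theta>: prob_space "P \<theta>" by (rule prP)
    \<comment> \<open>Integrability of the weight does not involve the index set, so the empty one
      is inserted.\<close>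
    have L: "integrable (P 0) ?L" by (rule S.change_of_measure_char(1)[OF I finite.emptyI]) simp
    have finQ: "finite_measure ?Q"
    proof (rule finite_measureI)
      have "emeasure ?Q (space ?Q) = (\<integral>\<^sup>+x. ennreal (?L x) \<partial>P 0)"
        by (simp add: emeasure_density cong: nn_integral_cong_simp)
      also have "\<dots> = ennreal (\<integral>x. ?L x \<partial>P 0)" by (rule nn_integral_eq_integral[OF L]) auto
      finally show "emeasure ?Q (space ?Q) \<noteq> \<infinity>" by simp
    qed
    interpret Q: finite_measure ?Q by (rule finQ)
    show ?thesis
    proof (rule measure_eqI_PiM_infinite[where I = "{0..T}" and M = "\<lambda>_. borel"])
      show "sets (P \<theta>) = sets (PiM {0..T} (\<lambda>_. borel))" by (simp add: setsP path_space_def)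
      show "sets ?Q = sets (PiM {0..T} (\<lambda>_. borel))" by (simp add: setsP path_space_def)
      show "finite_measure (P \<theta>)" by unfold_locales
      fix A :: "real \<Rightarrow> real set" and J
      assume J: "finite J" "J \<subseteq> {0..T}" and A: "\<And>i. i \<in> J \<Longrightarrow> A i \<in> sets borel"
      let ?E = "prod_emb {0..T} (\<lambda>_. borel) J (Pi\<^sub>E J A)"
      have E: "?E = {x \<in> space (path_space T). \<forall>j\<in>J. x j \<in> A j}"
        using J(2) by (auto simp: prod_emb_def path_space_def space_PiM PiE_iff restrict_def extensional_def)
      have "measure (P \<theta>) {x \<in> space (P \<theta>). \<forall>j\<in>J. x j \<in> A j} = measure ?Q {x \<in> space ?Q. \<forall>j\<in>J. x j \<in> A j}"
      proof (rule char_determines_joint_law[OF _ finQ J(1)])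
        show "finite_measure (P \<theta>)" by unfold_locales
        show "(\<lambda>x. x j) \<in> borel_measurable (P \<theta>)" "(\<lambda>x. x j) \<in> borel_measurable ?Q" if "j \<in> J" for j
          using that J coordP by auto
        show "(CLINT x|P \<theta>. iexp (\<Sum>j\<in>J. c j * x j)) = (CLINT x|?Q. iexp (\<Sum>j\<in>J. c j * x j))" for c
        proof -
          have lm: "(\<lambda>x. \<Sum>t\<in>J. c t * x t) \<in> borel_measurable (P 0)"
            using lin_m[OF J(2)] measurable_cong_sets[OF setsP refl] by blast
          note [measurable] = lm
          have lm': "(\<lambda>x. \<Sum>t\<in>J. c t * (\<theta> * t + x t)) \<in> borel_measurable (path_space T)"
            using J by (intro borel_measurable_sum borel_measurable_times borel_measurable_add borel_measurable_const coord) auto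
          note [measurable] = lm'
          \<comment> \<open>The weighted coordinates are first replaced by shifted coordinates under
            \<open>P 0\<close>; pulling back to \<open>M\<close> then turns these into the values of
            \<open>\<theta> * t + B t\<close>, whose law is \<open>P \<theta>\<close>.\<close>
          have "(CLINT x|?Q. iexp (\<Sum>j\<in>J. c j * x j)) = (CLINT x|P 0. ?L x *\<^sub>R iexp (\<Sum>j\<in>J. c j * x j))"
            by (rule integral_density) (auto simp del: of_real_sum)
          also have "\<dots> = (CLINT x|P 0. iexp (\<Sum>t\<in>J. c t * (\<theta> * t + x t)))"
            by (rule S.change_of_measure_char(2)[OF I J])
          also have "\<dots> = (CLINT \<omega>|M. iexp (\<Sum>t\<in>J. c t * (\<theta> * t + (\<lambda>t\<in>{0..T}. 0 * t + B t \<omega>) t)))"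
            by (rule intP) (simp del: of_real_sum)
          also have "\<dots> = (CLINT \<omega>|M. iexp (\<Sum>t\<in>J. c t * (\<theta> * t + B t \<omega>)))"
          proof (intro Bochner_Integration.integral_cong refl)
            fix \<omega>
            have "(\<Sum>t\<in>J. c t * (\<theta> * t + (\<lambda>t\<in>{0..T}. 0 * t + B t \<omega>) t)) = (\<Sum>t\<in>J. c t * (\<theta> * t + B t \<omega>))"
              using J by (intro sum.cong) auto
            then show "iexp (\<Sum>t\<in>J. c t * (\<theta> * t + (\<lambda>t\<in>{0..T}. 0 * t + B t \<omega>) t)) = iexp (\<Sum>t\<in>J. c t * (\<theta> * t + B t \<omega>))"
              by (rule arg_cong)
          qed
          also have "\<dots> = (CLINT x|P \<theta>. iexp (\<Sum>t\<in>J. c t * x t))"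
            by (rule charP[OF J, symmetric])
          finally show ?thesis by (rule sym)
        qed
      qed (rule A)
      then have "measure (P \<theta>) ?E = measure ?Q ?E"
        unfolding E by (simp add: spP)
      then show "emeasure (P \<theta>) ?E = emeasure ?Q ?E"
        unfolding P\<theta>.emeasure_eq_measure Q.emeasure_eq_measure by (rule arg_cong)
    qed
  qed
  \<comment> \<open>Existence of an integral is what turns the formula for all \<open>I\<close> into
    absolute continuity.\<close>
  obtain I where I: "ms_integral (P 0) (\<lambda>t x. x t) T h I" using ex by blast
  then have [measurable]: "I \<in> borel_measurable (P 0)" by (simp add: ms_integral_def)
  have "absolutely_continuous (P 0) (P \<theta>)"
    unfolding main[OF I] by (rule absolutely_continuousI_density) measurable
  then show ?thesis
    using ex main unfolding H P_def by blast
qed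

end
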